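(* Let $N\ge1$ be an integer. In the model described in the context, the average dual-mode networked sensing information rate obtained through cooperation among $N$ base stations, $\mathcal R_{s_{\mathrm{avg}}}=M\,\mathbb E[\log(1+\mathrm{SINR}_{\mathrm{net}})]$, is $$\mathcal R_{s_{\mathrm{avg}}}=M\int_0^\infty\left(\int_0^\infty\Big\{1-\Big[(1-\mathcal P_M(R_1,t))\prod_{n=2}^N(1-\mathcal P_{B_n}(R_1,t))\Big]\Big\}\,dt\right)2\pi\lambda_{BS}R_1e^{-\pi\lambda_{BS}R_1^2}\,dR_1,$$ where, with $\phi=e^t-1$, $$\mathcal P_M(R_1,t)=\exp\!\left(-\lambda_{cl}\frac{c\theta_BR_1}{2W_b}\frac{\phi\sigma_{\mathrm{av}_{cl}}}{\sigma_{\mathrm{av}_t}+\phi\sigma_{\mathrm{av}_{cl}}}\right)\mathcal L_{IC}\!\left(\frac{\phi R_1^{\eta_L}}{\sigma_{\mathrm{av}_t}};\frac{c\theta_BR_1}{2W_b}\right)\exp\!\left(-\frac{\phi(4\pi)^3R_1^{2\eta_L}(K_BTW_b+P_c\zeta)}{P_sG_m^2\lambda^2\sigma_{\mathrm{av}_t}}\right)\mathcal L_D\!\left(\frac{\phi(4\pi)^3R_1^{2\eta_L}}{P_sG_m^2\lambda^2\sigma_{\mathrm{av}_t}}\right),$$ $$\mathcal P_{B_n}(R_1,t)=\int_{R_1}^\infty\!\int_0^\pi\frac{p_{LOS}(R_n)(M-1)}{M}\exp\!\left(-\lambda_{cl}\frac{cR_n\theta_B}{2W_b\cos^2(\beta/2)}\frac{\phi\sigma_{\mathrm{av}_{cl}}}{\sigma_{\mathrm{av}_t}+\phi\sigma_{\mathrm{av}_{cl}}}\right)\mathcal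 L_{IC}\!\left(\frac{\phi R_1^{\eta_L}}{\sigma_{\mathrm{av}_t}\cos(\beta/2)};\frac{cR_n\theta_B}{2W_b\cos^2(\beta/2)}\right)$$ $$\times\exp\!\left(-\frac{\phi(4\pi)^3R_1^{\eta_L}R_n^{\eta_L}K_BTW_b}{P_sG_m^2\lambda^2\cos(\beta/2)\sigma_{\mathrm{av}_t}}\right)\mathcal L_D\!\left(\frac{\phi(4\pi)^3R_1^{\eta_L}R_n^{\eta_L}}{P_sG_m^2\lambda^2\cos(\beta/2)\sigma_{\mathrm{av}_t}}\right)\frac{2(\lambda_{BS}\pi)^{n-1}}{(n-2)!}(R_n^2-R_1^2)^{n-2}R_ne^{-\lambda_{BS}\pi(R_n^2-R_1^2)}\frac1\pi\,d\beta\,dR_n,$$ and where, for $s>0$ and $a>0$, $$\mathcal L_{IC}(s;a)=\int_{R_1}^\infty\!\int_0^\pi \exp\!\left(-\frac{2\pi\lambda_{BS}}{M}\int_{R_{IC}}^\infty p_{LOS}(r)\Big(1-\frac{1}{1+s\cos(\beta_I/2)r^{-\eta_L}\sigma_{\mathrm{av}_t}}\Big)r\,dr\right)$$ $$\times\exp\!\left(-\frac{\lambda_{BS}}{M}\int_{R_{IC}}^\infty p_{LOS}(r)\Big(1-\exp\Big(-\lambda_{cl}\,a\,\frac{s\cos(\beta_I/2)r^{-\eta_L}\sigma_{\mathrm{av}_{cl}}}{1+s\cos(\beta_I/2)r^{-\eta_L}\sigma_{\mathrm{av}_{cl}}}\Big)\Big)2\pi r\,dr\right)2\lambda_{BS}R_{IC}e^{-\lambda_{BS}\pi(R_{IC}^2-R_1^2)}\,d\beta_I\,dR_{IC},$$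 $$\mathcal L_D(s)=\int_0^\infty\exp\!\left(-\frac{2\pi\lambda_{BS}}{M^2}\int_{R_d}^\infty p_{LOS}(r)\Big(1-\Big(1+\frac{sP_cG_m^2C_Lr^{-\eta_L}}{m_L}\Big)^{-m_L}\Big)r\,dr\right)$$ $$\times\exp\!\left(-\frac{2\pi\lambda_{BS}}{M^2}\int_{R_d}^\infty (1-p_{LOS}(r))\Big(1-\Big(1+\frac{sP_cG_m^2C_Nr^{-\eta_N}}{m_N}\Big)^{-m_N}\Big)r\,dr\right)2\pi\lambda_{BS}R_de^{-\pi\lambda_{BS}R_d^2}\,dR_d .$$
   Context: Parameters: $\lambda_{BS},\lambda_{cl},P_s,P_c,G_m,C_L,C_N,\eta_L,\eta_N,m_L,m_N,c,\theta_B,W_b,K_B,T,\lambda,\gamma,\sigma_{\mathrm{av}_t},\sigma_{\mathrm{av}_{cl}}>0$, $\zeta\ge0$, $M$ a positive integer (number of beams per base station); $p_{LOS}(r)=e^{-\gamma r}$; convention $\exp(-\infty)=0$; $\log$ is the natural logarithm; both sides of the claim are read in $[0,\infty]$. PPP means Poisson point process. The distance $R_1$ from the target to its nearest base station has density $2\pi\lambda_{BS}R_1e^{-\pi\lambda_{BS}R_1^2}$ on $[0,\infty)$. Conditionally on $R_1$, the variables $\mathrm{SINR}_M,\mathrm{SINR}_{B_2},\dots,\mathrm{SINR}_{B_N}$ are independent (standing assumption), with the laws below, and $\mathrm{SINR}_{\mathrm{net}}=\max(\mathrm{SINR}_M,\mathrm{SINR}_{B_2},\dots,\mathrm{SINR}_{B_N})$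 (selection combining). Building blocks (conditionally on $R_1$). (i) $\sigma_{tm}$ is exponential with mean $\sigma_{\mathrm{av}_t}$. (ii) For $a>0$, $S(a)$ denotes $\sum_{cl\in\Phi_{cl}\cap A}\sigma_{cm}$, where $\Phi_{cl}$ is a homogeneous PPP on $\mathbb R^2$ of intensity $\lambda_{cl}$, $A$ a region of area $a$, and the scatterers carry i.i.d. exponential cross-sections $\sigma_{cm}$ of mean $\sigma_{\mathrm{av}_{cl}}$. (iii) For $a>0$, $(I_1(a),I_2(a))$ is defined as follows: $R_{IC}$ has density $2\pi\lambda_{BS}R_{IC}e^{-\lambda_{BS}\pi(R_{IC}^2-R_1^2)}$ on $[R_1,\infty)$, $\beta_I$ is independent and uniform on $[0,\pi]$; given these, interferers form a PPP on $\{x\in\mathbb R^2:|x|>R_{IC}\}$ of intensity $p_{LOS}(|x|)\lambda_{BS}/M$, with distances $R_v=|x|$ from the target, and $I_1(a)=\sum_v\cos(\beta_I/2)R_v^{-\eta_L}\sigma_{tm,v}$, $I_2(a)=\sum_v\cos(\beta_I/2)R_v^{-\eta_L}S_v$ with $\sigma_{tm,v}$ i.i.d. copies of $\sigma_{tm}$ and $S_v$ i.i.d. copies of $S(a)$; $I_1(a)$ and $I_2(a)$ are treated as independent given $(R_{IC},\beta_I)$. (iv) $I_{L_s},I_{N_s}$: $R_d$ has density $2\pi\lambda_{BS}R_de^{-\pi\lambda_{BS}R_d^2}$ on $[0,\infty)$; given $R_d$, $\Phi_{L_s},\Phi_{N_s}$ are independent PPPs on $\{|x|>R_d\}$ of intensities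 $p_{LOS}(|x|)\lambda_{BS}/M^2$ and $(1-p_{LOS}(|x|))\lambda_{BS}/M^2$; $I_{L_s}=\sum_{x_i\in\Phi_{L_s}}P_ch_{L,i}G_m^2C_L|x_i|^{-\eta_L}$, $I_{N_s}=\sum_{x_i\in\Phi_{N_s}}P_ch_{N,i}G_m^2C_N|x_i|^{-\eta_N}$, with $h_{L,i}$ (resp. $h_{N,i}$) i.i.d. Gamma of shape $m_L$ (resp. $m_N$) and mean $1$, independent of everything else. Within each SINR the blocks (i)-(iv) are mutually independent. Put $\kappa=P_sG_m^2\lambda^2/(4\pi)^3$. Monostatic: with $a=\frac{c\theta_BR_1}{2W_b}$, $$\mathrm{SINR}_M=\frac{\kappa\sigma_{tm}R_1^{-2\eta_L}}{\kappa R_1^{-2\eta_L}S(a)+\kappa R_1^{-\eta_L}(I_1(a)+I_2(a))+K_BTW_b+I_{L_s}+I_{N_s}+P_c\zeta}.$$ Bistatic at the $n$-th nearest base station ($n\ge2$): given $R_1$, $R_n$ has density $\frac{2(\lambda_{BS}\pi)^{n-1}}{(n-2)!}(R_n^2-R_1^2)^{n-2}R_ne^{-\lambda_{BS}\pi(R_n^2-R_1^2)}$ on $[R_1,\infty)$, and $\beta$ is independent and uniform on $[0,\pi]$; given $(R_n,\beta)$, $\mathbb 1_{c_1}$ is Bernoulli with success probability $p_{LOS}(R_n)\frac{M-1}{M}$, independent of blocks (i)-(iv); with $a=\frac{cR_n\theta_B}{2W_b\cos^2(\beta/2)}$, $$\mathrm{SINR}_{B_n}=\frac{\mathbb 1_{c_1}\kappa\sigma_{tm}\cos(\beta/2)R_1^{-\eta_L}R_n^{-\eta_L}}{\kappa\cos(\beta/2)R_1^{-\eta_L}R_n^{-\eta_L}S(a)+\kappa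 R_n^{-\eta_L}(I_1(a)+I_2(a))+K_BTW_b+I_{L_s}+I_{N_s}}.$$ *)

theory Defs
  imports "HOL-Probability.Probability"
begin

section \<open>Poisson processes and shot noise\<close>

text \<open>
  A point process is presented by a random number \<open>K\<close> of points (possibly infinite) and an
  enumeration \<open>X 0, X 1, \<dots>\<close>, of which only the \<open>X i\<close> with \<open>i < K\<close> are points of the process.
\<close>

definition point_count ::
    "('w \<Rightarrow> enat) \<Rightarrow> (nat \<Rightarrow> 'w \<Rightarrow> 'x) \<Rightarrow> 'x set \<Rightarrow> 'w \<Rightarrow> ennreal" where
  "point_count K X B w = emeasure (count_space UNIV) {i. enat i < K w \<and> X i w \<in> B}"

definition poisson_process ::
    "'w measure \<Rightarrow> 'x::topological_space measure \<Rightarrow> ('w \<Rightarrow> enat) \<Rightarrow> (nat \<Rightarrow> 'w \<Rightarrow> 'x) \<Rightarrow> bool" where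
  "poisson_process P \<Lambda> K X \<longleftrightarrow>
     prob_space P \<and>
     K \<in> measurable P (count_space UNIV) \<and>
     (\<forall>i. X i \<in> borel_measurable P) \<and>
     (\<forall>B\<in>sets borel.
        if emeasure \<Lambda> B < \<infinity>
        then (\<forall>k. measure P {w\<in>space P. point_count K X B w = of_nat k}
                   = exp (- measure \<Lambda> B) * measure \<Lambda> B ^ k / fact k)
        else (AE w in P. point_count K X B w = \<infinity>)) \<and>
     (\<forall>(I::nat set) B. finite I \<longrightarrow> (\<forall>i\<in>I. B i \<in> sets borel) \<longrightarrow> disjoint_family_on B I \<longrightarrow>
        prob_space.indep_vars P (\<lambda>_. borel) (\<lambda>i. point_count K X (B i)) I)"

text \<open>
  \<open>shot_noise_law \<Lambda> f m \<nu>\<close>: the measure \<open>\<nu>\<close> is the law of \<open>\<Sum>\<^sub>x f x * h\<^sub>x\<close>, where \<open>x\<close> runs through a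
  Poisson process of intensity measure \<open>\<Lambda>\<close> and the marks \<open>h\<^sub>x\<close> are i.i.d. with law \<open>m\<close> and
  independent of the process. The Poisson process is realised on its canonical space
  of pairs (number of points, enumeration), which is no loss of generality since only laws matter.
  The sum may be infinite.
\<close>

definition shot_noise_law ::
    "'x::topological_space measure \<Rightarrow> ('x \<Rightarrow> ennreal) \<Rightarrow> ennreal measure \<Rightarrow> ennreal measure \<Rightarrow> bool" where
  "shot_noise_law \<Lambda> f m \<nu> \<longleftrightarrow>
     (\<exists>Q :: (enat \<times> (nat \<Rightarrow> 'x)) measure.
        sets Q = sets (count_space UNIV \<Otimes>\<^sub>M PiM UNIV (\<lambda>_. borel)) \<and>
        poisson_process Q \<Lambda> fst (\<lambda>i w. snd w i) \<and>
        \<nu> = distr (Q \<Otimes>\<^sub>M PiM UNIV (\<lambda>_::nat. m)) borel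
              (\<lambda>((K, x), h). \<Sum>i. if enat i < K then f (x i) * h i else 0))"

section \<open>Conditional laws\<close>

text \<open>
  \<open>mixture_law M N C \<mu>\<close>: \<open>\<mu>\<close> is the law of a random element of \<open>N\<close> whose conditional law given
  \<open>Z = z\<close> satisfies \<open>C z\<close>, where \<open>Z\<close> has law \<open>M\<close>.
\<close>

definition mixture_law ::
    "'z measure \<Rightarrow> 'x measure \<Rightarrow> ('z \<Rightarrow> 'x measure \<Rightarrow> bool) \<Rightarrow> 'x measure \<Rightarrow> bool" where
  "mixture_law M N C \<mu> \<longleftrightarrow>
     (\<exists>\<kappa>\<in>measurable M (prob_algebra N). (AE z in M. C z (\<kappa> z)) \<and> \<mu> = bind M \<kappa>)"

text \<open>
  \<open>conditional_law P MZ Z MX X C\<close>: there is a regular conditional distribution of \<open>X\<close> given \<open>Z\<close>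
  whose value at almost every \<open>z\<close> satisfies \<open>C z\<close>.
\<close>

definition conditional_law ::
    "'w measure \<Rightarrow> 'z measure \<Rightarrow> ('w \<Rightarrow> 'z) \<Rightarrow> 'x measure \<Rightarrow> ('w \<Rightarrow> 'x) \<Rightarrow>
     ('z \<Rightarrow> 'x measure \<Rightarrow> bool) \<Rightarrow> bool" where
  "conditional_law P MZ Z MX X C \<longleftrightarrow>
     Z \<in> measurable P MZ \<and> X \<in> measurable P MX \<and>
     (\<exists>\<kappa>\<in>measurable MZ (prob_algebra MX).
        (AE z in distr P MZ Z. C z (\<kappa> z)) \<and>
        distr P (MZ \<Otimes>\<^sub>M MX) (\<lambda>w. (Z w, X w)) =
          bind (distr P MZ Z) (\<lambda>z. distr (\<kappa> z) (MZ \<Otimes>\<^sub>M MX) (Pair z)))"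

section \<open>The sensing network\<close>

record params =
  lam_BS :: real
  lam_cl :: real
  P_s :: real
  P_c :: real
  G_m :: real
  C_L :: real
  C_N :: real
  eta_L :: real
  eta_N :: real
  m_L :: real
  m_N :: real
  c_light :: real
  theta_B :: real
  W_b :: real
  K_B :: real
  temp :: real
  wavelength :: real
  gam :: real
  sig_t :: real
  sig_cl :: real
  zeta :: real
  beams :: nat

definition valid_params :: "params \<Rightarrow> bool" where
  "valid_params p \<longleftrightarrow>
     lam_BS p > 0 \<and> lam_cl p > 0 \<and> P_s p > 0 \<and> P_c p > 0 \<and> G_m p > 0 \<and> C_L p > 0 \<and> C_N p > 0 \<and>
     eta_L p > 0 \<and> eta_N p > 0 \<and> m_L p > 0 \<and> m_N p > 0 \<and> c_light p > 0 \<and> theta_B p > 0 \<and>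
     W_b p > 0 \<and> K_B p > 0 \<and> temp p > 0 \<and> wavelength p > 0 \<and> gam p > 0 \<and>
     sig_t p > 0 \<and> sig_cl p > 0 \<and> zeta p \<ge> 0 \<and> beams p \<ge> 1"

definition p_LOS :: "params \<Rightarrow> real \<Rightarrow> real" where
  "p_LOS p r = exp (- gam p * r)"

definition kappa :: "params \<Rightarrow> real" where
  "kappa p = P_s p * (G_m p)\<^sup>2 * (wavelength p)\<^sup>2 / (4 * pi) ^ 3"

definition noise :: "params \<Rightarrow> real" where
  "noise p = K_B p * temp p * W_b p"

definition nearest_pdf :: "params \<Rightarrow> real \<Rightarrow> real" where
  "nearest_pdf p r = 2 * pi * lam_BS p * r * exp (- pi * lam_BS p * r\<^sup>2)"

definition interferer_pdf :: "params \<Rightarrow> real \<Rightarrow> real \<Rightarrow> real" where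
  "interferer_pdf p r1 r = 2 * pi * lam_BS p * r * exp (- lam_BS p * pi * (r\<^sup>2 - r1\<^sup>2))"

definition nth_nearest_pdf :: "params \<Rightarrow> nat \<Rightarrow> real \<Rightarrow> real \<Rightarrow> real" where
  "nth_nearest_pdf p n r1 r =
     2 * (lam_BS p * pi) ^ (n - 1) / fact (n - 2) * (r\<^sup>2 - r1\<^sup>2) ^ (n - 2) * r
       * exp (- lam_BS p * pi * (r\<^sup>2 - r1\<^sup>2))"

definition real_law_on :: "real set \<Rightarrow> (real \<Rightarrow> real) \<Rightarrow> real measure" where
  "real_law_on A f = density lborel (\<lambda>x. ennreal (f x) * indicator A x)"

definition nonneg_law :: "(real \<Rightarrow> real) \<Rightarrow> ennreal measure" where
  "nonneg_law f = distr (real_law_on {0..} f) borel ennreal"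

definition exp_law :: "real \<Rightarrow> ennreal measure" where
  "exp_law mean = nonneg_law (exponential_density (1 / mean))"

text \<open>Gamma law of shape \<open>m\<close> and mean 1, i.e. of rate \<open>m\<close>.\<close>

definition gamma_law :: "real \<Rightarrow> ennreal measure" where
  "gamma_law m = nonneg_law (\<lambda>x. m powr m / Gamma m * x powr (m - 1) * exp (- m * x))"

definition angle_law :: "real measure" where
  "angle_law = uniform_measure lborel {0..pi}"

text \<open>The rotation-invariant intensity \<open>g |x|\<close> on \<open>{x. |x| > R}\<close> in the plane.\<close>

definition outer_intensity :: "real \<Rightarrow> (real \<Rightarrow> real) \<Rightarrow> (real^2) measure" where
  "outer_intensity R g =
     density lborel (\<lambda>x. ennreal (g (norm x)) * indicator {x. norm x > R} x)"

subsection \<open>Laws of the building blocks\<close>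

definition clutter_law :: "params \<Rightarrow> real \<Rightarrow> ennreal measure \<Rightarrow> bool" where
  "clutter_law p a \<nu> \<longleftrightarrow>
     (\<exists>A\<in>sets (borel :: (real^2) measure). emeasure lborel A = ennreal a \<and>
        shot_noise_law (density lborel (\<lambda>_. ennreal (lam_cl p))) (indicator A)
          (exp_law (sig_cl p)) \<nu>)"

text \<open>Joint law of \<open>(I\<^sub>1(a), I\<^sub>2(a))\<close>, given \<open>R\<^sub>1 = r1\<close>; the mixing variable is \<open>(R\<^sub>I\<^sub>C, \<beta>\<^sub>I)\<close>.\<close>

definition IC_law :: "params \<Rightarrow> real \<Rightarrow> real \<Rightarrow> (ennreal \<times> ennreal) measure \<Rightarrow> bool" where
  "IC_law p r1 a =
     mixture_law (real_law_on {r1..} (interferer_pdf p r1) \<Otimes>\<^sub>M angle_law) (borel \<Otimes>\<^sub>M borel)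
       (\<lambda>(ric, b) \<nu>.
          let \<Lambda> = outer_intensity ric (\<lambda>r. p_LOS p r * lam_BS p / beams p);
              f = (\<lambda>x. ennreal (cos (b / 2) * norm x powr (- eta_L p)))
          in \<exists>S \<nu>1 \<nu>2. clutter_law p a S \<and>
               shot_noise_law \<Lambda> f (exp_law (sig_t p)) \<nu>1 \<and>
               shot_noise_law \<Lambda> f S \<nu>2 \<and>
               \<nu> = \<nu>1 \<Otimes>\<^sub>M \<nu>2)"

text \<open>Joint law of \<open>(I\<^sub>L\<^sub>s, I\<^sub>N\<^sub>s)\<close>; the mixing variable is \<open>R\<^sub>d\<close>.\<close>

definition D_law :: "params \<Rightarrow> (ennreal \<times> ennreal) measure \<Rightarrow> bool" where
  "D_law p =
     mixture_law (real_law_on {0..} (nearest_pdf p)) (borel \<Otimes>\<^sub>M borel)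
       (\<lambda>rd \<nu>. \<exists>\<nu>L \<nu>N.
          shot_noise_law (outer_intensity rd (\<lambda>r. p_LOS p r * lam_BS p / (beams p)\<^sup>2))
            (\<lambda>x. ennreal (P_c p * (G_m p)\<^sup>2 * C_L p * norm x powr (- eta_L p)))
            (gamma_law (m_L p)) \<nu>L \<and>
          shot_noise_law (outer_intensity rd (\<lambda>r. (1 - p_LOS p r) * lam_BS p / (beams p)\<^sup>2))
            (\<lambda>x. ennreal (P_c p * (G_m p)\<^sup>2 * C_N p * norm x powr (- eta_N p)))
            (gamma_law (m_N p)) \<nu>N \<and>
          \<nu> = \<nu>L \<Otimes>\<^sub>M \<nu>N)"

subsection \<open>Laws of the SINRs given the distance to the nearest base station\<close>

text \<open>
  SINRs are \<open>[0,\<infinity>]\<close>-valued; the denominators contain the positive thermal noise, and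
  an infinite interference makes the quotient 0.
\<close>

definition area_mono :: "params \<Rightarrow> real \<Rightarrow> real" where
  "area_mono p r1 = c_light p * theta_B p * r1 / (2 * W_b p)"

definition area_bi :: "params \<Rightarrow> real \<Rightarrow> real \<Rightarrow> real" where
  "area_bi p rn b = c_light p * rn * theta_B p / (2 * W_b p * (cos (b / 2))\<^sup>2)"

definition SINR_M_law :: "params \<Rightarrow> real \<Rightarrow> ennreal measure \<Rightarrow> bool" where
  "SINR_M_law p r1 \<nu> \<longleftrightarrow>
     (\<exists>LS LI LD. clutter_law p (area_mono p r1) LS \<and> IC_law p r1 (area_mono p r1) LI \<and> D_law p LD \<and>
        \<nu> = distr (exp_law (sig_t p) \<Otimes>\<^sub>M LS \<Otimes>\<^sub>M LI \<Otimes>\<^sub>M LD) borel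
          (\<lambda>(\<sigma>, S, (I1, I2), (IL, IN)).
             ennreal (kappa p * r1 powr (- 2 * eta_L p)) * \<sigma>
             / (ennreal (kappa p * r1 powr (- 2 * eta_L p)) * S
                + ennreal (kappa p * r1 powr (- eta_L p)) * (I1 + I2)
                + ennreal (noise p) + IL + IN + ennreal (P_c p * zeta p))))"

text \<open>Law of the bistatic SINR given, in addition, \<open>R\<^sub>n = rn\<close> and \<open>\<beta> = b\<close>.\<close>

definition SINR_B_cond_law :: "params \<Rightarrow> real \<Rightarrow> real \<Rightarrow> real \<Rightarrow> ennreal measure \<Rightarrow> bool" where
  "SINR_B_cond_law p r1 rn b \<nu> \<longleftrightarrow>
     (\<exists>LS LI LD. clutter_law p (area_bi p rn b) LS \<and> IC_law p r1 (area_bi p rn b) LI \<and> D_law p LD \<and>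
        \<nu> = distr (measure_pmf (bernoulli_pmf (p_LOS p rn * ((real (beams p) - 1) / beams p)))
                    \<Otimes>\<^sub>M exp_law (sig_t p) \<Otimes>\<^sub>M LS \<Otimes>\<^sub>M LI \<Otimes>\<^sub>M LD) borel
          (\<lambda>(c1, \<sigma>, S, (I1, I2), (IL, IN)).
             of_bool c1 *
             ennreal (kappa p * cos (b / 2) * r1 powr (- eta_L p) * rn powr (- eta_L p)) * \<sigma>
             / (ennreal (kappa p * cos (b / 2) * r1 powr (- eta_L p) * rn powr (- eta_L p)) * S
                + ennreal (kappa p * rn powr (- eta_L p)) * (I1 + I2)
                + ennreal (noise p) + IL + IN)))"

definition SINR_B_law :: "params \<Rightarrow> nat \<Rightarrow> real \<Rightarrow> ennreal measure \<Rightarrow> bool" where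
  "SINR_B_law p n r1 =
     mixture_law (real_law_on {r1..} (nth_nearest_pdf p n r1) \<Otimes>\<^sub>M angle_law) borel
       (\<lambda>(rn, b). SINR_B_cond_law p r1 rn b)"

text \<open>
  The model for \<open>N\<close> cooperating base stations on a probability space \<open>P\<close>. \<open>SINR 1\<close> is the
  monostatic SINR, \<open>SINR n\<close> with \<open>2 \<le> n \<le> N\<close> the bistatic SINR at the \<open>n\<close>-th nearest base station.
\<close>

definition sensing_model ::
    "params \<Rightarrow> nat \<Rightarrow> 'w measure \<Rightarrow> ('w \<Rightarrow> real) \<Rightarrow> (nat \<Rightarrow> 'w \<Rightarrow> ennreal) \<Rightarrow> bool" where
  "sensing_model p N P R1 SINR \<longleftrightarrow>
     prob_space P \<and>
     distributed P lborel R1 (\<lambda>r. ennreal (nearest_pdf p r) * indicator {0..} r) \<and>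
     conditional_law P borel R1 (PiM {1..N} (\<lambda>_. borel)) (\<lambda>w. \<lambda>n\<in>{1..N}. SINR n w)
       (\<lambda>r1 \<mu>. \<exists>L. SINR_M_law p r1 (L 1) \<and> (\<forall>n\<in>{2..N}. SINR_B_law p n r1 (L n)) \<and>
                   \<mu> = PiM {1..N} L)"

definition SINR_net :: "nat \<Rightarrow> (nat \<Rightarrow> 'w \<Rightarrow> ennreal) \<Rightarrow> 'w \<Rightarrow> ennreal" where
  "SINR_net N SINR w = Max ((\<lambda>n. SINR n w) ` {1..N})"

definition log1p_ennreal :: "ennreal \<Rightarrow> ennreal" where
  "log1p_ennreal x = (if x = \<infinity> then \<infinity> else ennreal (ln (1 + enn2real x)))"

definition avg_rate ::
    "params \<Rightarrow> nat \<Rightarrow> 'w measure \<Rightarrow> (nat \<Rightarrow> 'w \<Rightarrow> ennreal) \<Rightarrow> ennreal" where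
  "avg_rate p N P SINR = of_nat (beams p) * (\<integral>\<^sup>+ w. log1p_ennreal (SINR_net N SINR w) \<partial>P)"

section \<open>The integral expressions\<close>

text \<open>
  All expressions take values in \<open>[0,\<infinity>]\<close>: the interference integrals may diverge (e.g. if
  \<open>eta_N p \<le> 2\<close>). \<open>P_M\<close> and \<open>P_B\<close> are probabilities, so the truncated subtraction of
  \<^typ>\<open>ennreal\<close> is the usual one on \<open>1 - P_M\<close>, \<open>1 - P_B\<close>.
\<close>

text \<open>\<open>exp (- x)\<close> for \<open>x\<close> in \<open>[0,\<infinity>]\<close>, with \<open>exp (- \<infinity>) = 0\<close>.\<close>

definition exp_neg :: "ennreal \<Rightarrow> ennreal" where
  "exp_neg x = (if x = \<infinity> then 0 else ennreal (exp (- enn2real x)))"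

definition L_IC :: "params \<Rightarrow> real \<Rightarrow> real \<Rightarrow> real \<Rightarrow> ennreal" where
  "L_IC p r1 s a =
     (\<integral>\<^sup>+ ric\<in>{r1..}. (\<integral>\<^sup>+ b\<in>{0..pi}.
        exp_neg (ennreal (2 * pi * lam_BS p / beams p) *
          (\<integral>\<^sup>+ r\<in>{ric..}. ennreal (p_LOS p r *
             (1 - 1 / (1 + s * cos (b / 2) * r powr (- eta_L p) * sig_t p)) * r) \<partial>lborel)) *
        exp_neg (ennreal (lam_BS p / beams p) *
          (\<integral>\<^sup>+ r\<in>{ric..}. ennreal (p_LOS p r *
             (1 - exp (- lam_cl p * a * (s * cos (b / 2) * r powr (- eta_L p) * sig_cl p
                        / (1 + s * cos (b / 2) * r powr (- eta_L p) * sig_cl p)))) * (2 * pi * r)) \<partial>lborel)) *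
        ennreal (2 * lam_BS p * ric * exp (- lam_BS p * pi * (ric\<^sup>2 - r1\<^sup>2)))
      \<partial>lborel) \<partial>lborel)"

definition L_D :: "params \<Rightarrow> real \<Rightarrow> ennreal" where
  "L_D p s =
     (\<integral>\<^sup>+ rd\<in>{0..}.
        exp_neg (ennreal (2 * pi * lam_BS p / (beams p)\<^sup>2) *
          (\<integral>\<^sup>+ r\<in>{rd..}. ennreal (p_LOS p r *
             (1 - (1 + s * P_c p * (G_m p)\<^sup>2 * C_L p * r powr (- eta_L p) / m_L p) powr (- m_L p))
             * r) \<partial>lborel)) *
        exp_neg (ennreal (2 * pi * lam_BS p / (beams p)\<^sup>2) *
          (\<integral>\<^sup>+ r\<in>{rd..}. ennreal ((1 - p_LOS p r) *
             (1 - (1 + s * P_c p * (G_m p)\<^sup>2 * C_N p * r powr (- eta_N p) / m_N p) powr (- m_N p))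
             * r) \<partial>lborel)) *
        ennreal (2 * pi * lam_BS p * rd * exp (- pi * lam_BS p * rd\<^sup>2))
      \<partial>lborel)"

definition P_M :: "params \<Rightarrow> real \<Rightarrow> real \<Rightarrow> ennreal" where
  "P_M p r1 t =
     (let \<phi> = exp t - 1;
          a = c_light p * theta_B p * r1 / (2 * W_b p)
      in ennreal (exp (- lam_cl p * a * (\<phi> * sig_cl p / (sig_t p + \<phi> * sig_cl p)))) *
         L_IC p r1 (\<phi> * r1 powr eta_L p / sig_t p) a *
         ennreal (exp (- (\<phi> * (4 * pi) ^ 3 * r1 powr (2 * eta_L p)
                           * (K_B p * temp p * W_b p + P_c p * zeta p))
                       / (P_s p * (G_m p)\<^sup>2 * (wavelength p)\<^sup>2 * sig_t p))) *
         L_D p (\<phi> * (4 * pi) ^ 3 * r1 powr (2 * eta_L p)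
                 / (P_s p * (G_m p)\<^sup>2 * (wavelength p)\<^sup>2 * sig_t p)))"

definition P_B :: "params \<Rightarrow> nat \<Rightarrow> real \<Rightarrow> real \<Rightarrow> ennreal" where
  "P_B p n r1 t =
     (let \<phi> = exp t - 1 in
      \<integral>\<^sup>+ rn\<in>{r1..}. (\<integral>\<^sup>+ b\<in>{0..pi}.
        (let a = c_light p * rn * theta_B p / (2 * W_b p * (cos (b / 2))\<^sup>2) in
         ennreal (p_LOS p rn * (real (beams p) - 1) / beams p) *
         ennreal (exp (- lam_cl p * a * (\<phi> * sig_cl p / (sig_t p + \<phi> * sig_cl p)))) *
         L_IC p r1 (\<phi> * r1 powr eta_L p / (sig_t p * cos (b / 2))) a *
         ennreal (exp (- (\<phi> * (4 * pi) ^ 3 * r1 powr eta_L p * rn powr eta_L p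
                           * K_B p * temp p * W_b p)
                       / (P_s p * (G_m p)\<^sup>2 * (wavelength p)\<^sup>2 * cos (b / 2) * sig_t p))) *
         L_D p (\<phi> * (4 * pi) ^ 3 * r1 powr eta_L p * rn powr eta_L p
                 / (P_s p * (G_m p)\<^sup>2 * (wavelength p)\<^sup>2 * cos (b / 2) * sig_t p)) *
         ennreal (2 * (lam_BS p * pi) ^ (n - 1) / fact (n - 2) * (rn\<^sup>2 - r1\<^sup>2) ^ (n - 2) * rn
                   * exp (- lam_BS p * pi * (rn\<^sup>2 - r1\<^sup>2)) * (1 / pi)))
      \<partial>lborel) \<partial>lborel)"

end

theory Submission
  imports Defs
begin

text \<open>
  The cross-section of the target is exponential, so given clutter and interference the event \<open>SINR > \<phi>\<close> has
  probability \<open>exp (- s D)\<close>, where \<open>D\<close> is the denominator and \<open>s\<close> is proportional to \<open>\<phi>\<close>. Hence the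
  complementary distribution functions are products of Laplace transforms of shot noise, which are
  given by the Laplace functional of the Poisson process and, as intensities and responses
  depend on the norm only, reduce to one-dimensional integrals in polar coordinates. The expectation of
  \<open>ln (1 + SINR)\<close> is the integral over \<open>t\<close> of the probability of \<open>SINR > exp t - 1\<close>, and the maximum of
  independent variables stays below \<open>\<phi>\<close> with the product of the individual probabilities.
\<close>

section \<open>The function \<open>exp_neg\<close>\<close>

text \<open>The laws of the model are given by relations rather than by functions: a mixing kernel
  is known only to satisfy its relation at almost every parameter, and the relation is not known in
  advance to determine the measure. So each step shows that every measure standing in the relation
  gives the same value to a fixed test function; this value then replaces the kernel integral almost
  everywhere, and measurability is inherited from the kernel. Working with \<open>exp_neg\<close> on
  [0,\<infinity>] settles divergence: an infinite interference sum or a divergent intensity integral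
  contributes the value 0, in accordance with an SINR equal to 0, so no condition on the path-loss
  exponents enters. The other obstacle is degenerate points, all of them null sets: at t = 0 the
  tail formula fails for an infinite denominator, at r1 = 0 the powers of r1 are 0 by the convention
  0 powr x = 0, and at a bistatic angle equal to pi the factor cos (b / 2) vanishes.\<close>

lemma exp_neg_0 [simp]: "exp_neg 0 = 1"
  by (simp add: exp_neg_def)

lemma exp_neg_top [simp]: "exp_neg \<top> = 0"
  by (simp add: exp_neg_def)

lemma exp_neg_ennreal: "0 \<le> x \<Longrightarrow> exp_neg (ennreal x) = ennreal (exp (- x))"
  by (simp add: exp_neg_def)

lemma exp_neg_add: "exp_neg (x + y) = exp_neg x * exp_neg y"
  by (cases x; cases y)
     (auto simp: exp_neg_ennreal exp_add[symmetric] ennreal_mult[symmetric] simp flip: ennreal_plus)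

lemma exp_neg_sum: "finite A \<Longrightarrow> exp_neg (\<Sum>i\<in>A. f i) = (\<Prod>i\<in>A. exp_neg (f i))"
  by (induction A rule: finite_induct) (auto simp: exp_neg_add)

lemma exp_neg_mult_of_nat: "exp_neg (c * of_nat k) = exp_neg c ^ k"
  by (induction k) (auto simp: distrib_left exp_neg_add)

lemma exp_neg_antimono: "x \<le> y \<Longrightarrow> exp_neg y \<le> exp_neg x"
  by (cases x; cases y) (auto simp: exp_neg_ennreal top_unique)

lemma exp_neg_le_1 [simp]: "exp_neg x \<le> 1"
  using exp_neg_antimono[of 0 x] by simp

lemma exp_neg_finite [simp]: "exp_neg x \<noteq> \<top>" "exp_neg x < \<top>"
  using exp_neg_le_1[of x] by (auto simp: top_unique less_top[symmetric] simp del: exp_neg_le_1)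

lemma exp_neg_eq_1_iff [simp]: "exp_neg x = 1 \<longleftrightarrow> x = 0"
  by (cases x) (auto simp: exp_neg_ennreal)

lemma measurable_exp_neg [measurable]: "exp_neg \<in> borel_measurable borel"
  unfolding exp_neg_def by measurable

text \<open>Continuity at \<infinity> is included, which is what limits of possibly infinite sums
  and integrals require. For an infinite limit, X eventually exceeds every level, and the level - ln
  e pushes \<open>exp_neg\<close> below e; \<open>max 0\<close> keeps this level nonnegative when e
  \<ge> 1.\<close>

lemma tendsto_exp_neg:
  assumes "(X \<longlongrightarrow> L) F"
  shows "((\<lambda>i. exp_neg (X i)) \<longlongrightarrow> exp_neg L) F"
proof (cases L)
  case (real l)
  have "\<forall>\<^sub>F i in F. X i < \<top>"
    using order_tendstoD(2)[OF assms, of \<top>] real by simp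
  then have ev: "\<forall>\<^sub>F i in F. ennreal (exp (- enn2real (X i))) = exp_neg (X i)"
    by eventually_elim (simp add: exp_neg_def)
  have "((\<lambda>i. enn2real (X i)) \<longlongrightarrow> l) F"
  proof (rule tendsto_enn2real)
    show "(X \<longlongrightarrow> ennreal l) F" using assms real by simp
    show "0 \<le> l" using real by simp
  qed
  then have "((\<lambda>i. ennreal (exp (- enn2real (X i)))) \<longlongrightarrow> ennreal (exp (- l))) F"
    by (intro tendsto_ennrealI tendsto_exp tendsto_minus)
  then show ?thesis
    unfolding tendsto_cong[OF ev] using real by (simp add: exp_neg_ennreal)
next
  case top
  show ?thesis
  proof (rule order_tendstoI)
    fix a assume "exp_neg L < a"
    then have "0 < a" by (simp add: top)
    then obtain e' where e': "0 < e'" "e' < a" by (auto dest: dense)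
    obtain e where e: "e > 0" "ennreal e < a"
      using e' by (cases e') auto
    have "\<forall>\<^sub>F i in F. ennreal (max 0 (- ln e)) < X i"
      using order_tendstoD(1)[OF assms, of "ennreal (max 0 (- ln e))"] top by simp
    then show "\<forall>\<^sub>F i in F. exp_neg (X i) < a"
    proof eventually_elim
      case (elim i)
      have "exp_neg (X i) \<le> exp_neg (ennreal (max 0 (- ln e)))"
        using elim by (intro exp_neg_antimono) simp
      also have "\<dots> = ennreal (exp (- max 0 (- ln e)))"
        by (rule exp_neg_ennreal) simp
      also have "\<dots> \<le> ennreal (exp (ln e))"
        by (intro ennreal_leI) simp
      also have "\<dots> < a" using e by simp
      finally show ?case .
    qed
  qed (use top in simp)
qed

text \<open>A right inverse of \<open>exp_neg\<close> on [0,1]. It turns the mean effect of a random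
  mark, a number in [0,1], into a deterministic response, so that the Laplace functional of an
  unmarked process also covers marked ones. The value at 0 is spelled out because ln 0 = 0 in
  HOL.\<close>

definition neg_ln :: "ennreal \<Rightarrow> ennreal" where
  "neg_ln y = (if y = 0 then \<infinity> else ennreal (- ln (enn2real y)))"

lemma measurable_neg_ln [measurable]: "neg_ln \<in> borel_measurable borel"
  unfolding neg_ln_def by measurable

lemma exp_neg_neg_ln: "y \<le> 1 \<Longrightarrow> exp_neg (neg_ln y) = y"
  by (cases y) (auto simp: neg_ln_def exp_neg_ennreal top_unique)

section \<open>The Laplace functional of a Poisson process\<close>

text \<open>Written as an integral over the counting measure so that monotone convergence applies.\<close>

definition point_sum ::
    "('w \<Rightarrow> enat) \<Rightarrow> (nat \<Rightarrow> 'w \<Rightarrow> 'x) \<Rightarrow> ('x \<Rightarrow> ennreal) \<Rightarrow> 'w \<Rightarrow> ennreal" where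
  "point_sum K X u w = (\<integral>\<^sup>+ i. (if enat i < K w then u (X i w) else 0) \<partial>count_space UNIV)"

lemma point_count_eq: "point_count K X B w = point_sum K X (indicator B) w"
proof -
  have "point_count K X B w = (\<integral>\<^sup>+ i. indicator {i. enat i < K w \<and> X i w \<in> B} i \<partial>count_space UNIV)"
    by (simp add: point_count_def)
  also have "\<dots> = point_sum K X (indicator B) w"
    unfolding point_sum_def by (intro nn_integral_cong) (auto simp: indicator_def)
  finally show ?thesis .
qed

lemma measurable_point_sum [measurable]:
  assumes [measurable]: "K \<in> measurable P (count_space UNIV)" "\<And>i. X i \<in> borel_measurable P"
    "u \<in> borel_measurable borel"
  shows "point_sum K X u \<in> borel_measurable P"
  unfolding point_sum_def nn_integral_count_space_nat by measurable

lemma poisson_process_measurable: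
  assumes "poisson_process P \<Lambda> K X"
  shows "prob_space P" "K \<in> measurable P (count_space UNIV)" "\<And>i. X i \<in> borel_measurable P"
  using assms by (auto simp: poisson_process_def)

text \<open>With z = \<open>exp_neg c\<close> this is the generating function of the Poisson law,
  \<Sum> z^k exp (- m) m^k / k! = exp (- m (1 - z)). For an infinite mean the count is infinite
  almost surely; both sides are then 0, or both 1 if c = 0, by the convention 0 * \<infinity> =
  0.\<close>

lemma poisson_process_laplace_count:
  assumes "poisson_process P \<Lambda> K X" and B[measurable]: "B \<in> sets borel"
  shows "(\<integral>\<^sup>+ w. exp_neg (c * point_count K X B w) \<partial>P) = exp_neg ((1 - exp_neg c) * emeasure \<Lambda> B)"
proof -
  note [measurable] = poisson_process_measurable(2,3)[OF assms(1)]
  interpret prob_space P by (rule poisson_process_measurable(1)[OF assms(1)])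
  let ?N = "point_count K X B"
  have counts: "if emeasure \<Lambda> B < \<infinity>
      then \<forall>k. measure P {w\<in>space P. ?N w = of_nat k} = exp (- measure \<Lambda> B) * measure \<Lambda> B ^ k / fact k
      else AE w in P. ?N w = \<infinity>"
    using assms unfolding poisson_process_def by blast
  have [measurable]: "?N \<in> borel_measurable P"
    unfolding point_count_eq[abs_def] by measurable
  show ?thesis
  proof (cases "emeasure \<Lambda> B < \<infinity>")
    case False
    then have "AE w in P. ?N w = \<infinity>"
      using counts by (simp add: not_less top_unique)
    then have "(\<integral>\<^sup>+ w. exp_neg (c * ?N w) \<partial>P) = (\<integral>\<^sup>+ w. exp_neg (c * \<top>) \<partial>P)"
      by (intro nn_integral_cong_AE) auto
    also have "\<dots> = exp_neg ((1 - exp_neg c) * emeasure \<Lambda> B)"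
    proof (cases "c = 0")
      case False
      then have "exp_neg c < 1" using exp_neg_eq_1_iff[of c] exp_neg_le_1[of c] by (simp add: less_le)
      then have "1 - exp_neg c \<noteq> 0" by (simp add: diff_eq_0_iff_ennreal)
      then show ?thesis
        using False \<open>\<not> emeasure \<Lambda> B < \<infinity>\<close> by (simp add: ennreal_mult_top less_top[symmetric] emeasure_space_1)
    qed (simp add: emeasure_space_1)
    finally show ?thesis .
  next
    case True
    define m where "m = measure \<Lambda> B"
    have m: "emeasure \<Lambda> B = ennreal m" "m \<ge> 0"
      using True by (auto simp: m_def emeasure_eq_ennreal_measure)
    have q: "measure P {w\<in>space P. ?N w = of_nat k} = exp (- m) * m ^ k / fact k" for k
      using counts True by (auto simp: m_def)
    \<comment> \<open>Used with z = 1 to see that the finite counts carry total mass 1, so that an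
      infinite count is a null event, and with z = \<open>exp_neg c\<close> for the transform
      itself.\<close>
    have mgf: "(\<Sum>k. ennreal (z ^ k * (exp (- m) * m ^ k / fact k))) = ennreal (exp (- m + z * m))"
      if "z \<ge> 0" for z
    proof (rule suminf_ennreal_eq)
      have "(\<lambda>k. exp (- m) * ((z * m) ^ k /\<^sub>R fact k)) sums (exp (- m) * exp (z * m))"
        by (intro sums_mult exp_converges)
      then show "(\<lambda>k. z ^ k * (exp (- m) * m ^ k / fact k)) sums exp (- m + z * m)"
        unfolding exp_add by (simp add: power_mult_distrib field_simps)
    qed (use that m in auto)
    have disj: "disjoint_family (\<lambda>k::nat. {w\<in>space P. ?N w = of_nat k})"
      by (auto simp: disjoint_family_on_def)
    have "emeasure P (\<Union>k::nat. {w\<in>space P. ?N w = of_nat k})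
        = (\<Sum>k. emeasure P {w\<in>space P. ?N w = of_nat k})"
      using disj by (intro suminf_emeasure[symmetric]) auto
    also have "\<dots> = 1"
      using mgf[of 1] by (simp add: emeasure_eq_measure q)
    finally have "AE w in P. w \<in> (\<Union>k::nat. {w\<in>space P. ?N w = of_nat k})"
      by (intro AE_in_set_eq_1[THEN iffD2]) (auto simp: measure_def)
    then have "AE w in P. exp_neg (c * ?N w) =
        (\<Sum>k. exp_neg c ^ k * indicator {w\<in>space P. ?N w = of_nat k} w)"
    proof eventually_elim
      case (elim w)
      then obtain k where k: "w \<in> space P" "?N w = of_nat k" by auto
      have "(\<Sum>j. exp_neg c ^ j * indicator {w\<in>space P. ?N w = of_nat j} w)
          = (\<Sum>j\<in>{k}. exp_neg c ^ j * indicator {w\<in>space P. ?N w = of_nat j} w)"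
        by (rule suminf_finite) (auto simp: k)
      then show ?case using k by (simp add: exp_neg_mult_of_nat)
    qed
    then have "(\<integral>\<^sup>+ w. exp_neg (c * ?N w) \<partial>P)
        = (\<integral>\<^sup>+ w. (\<Sum>k. exp_neg c ^ k * indicator {w\<in>space P. ?N w = of_nat k} w) \<partial>P)"
      by (rule nn_integral_cong_AE)
    also have "\<dots> = (\<Sum>k. exp_neg c ^ k * emeasure P {w\<in>space P. ?N w = of_nat k})"
      by (subst nn_integral_suminf) (auto simp: nn_integral_cmult_indicator)
    also have "\<dots> = exp_neg ((1 - exp_neg c) * emeasure \<Lambda> B)"
    proof -
      obtain z where z: "exp_neg c = ennreal z" "z \<ge> 0" by (cases "exp_neg c") auto
      with exp_neg_le_1[of c] have "z \<le> 1" by simp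
      have "(\<Sum>k. exp_neg c ^ k * emeasure P {w\<in>space P. ?N w = of_nat k}) = ennreal (exp (- m + z * m))"
        by (subst mgf[OF z(2), symmetric]) (simp add: z m emeasure_eq_measure q ennreal_power flip: ennreal_mult)
      also have "\<dots> = exp_neg (ennreal ((1 - z) * m))"
        using \<open>z \<le> 1\<close> m mult_left_mono[of z 1 m] by (subst exp_neg_ennreal) (auto simp: algebra_simps)
      also have "ennreal ((1 - z) * m) = (1 - exp_neg c) * emeasure \<Lambda> B"
        using \<open>z \<le> 1\<close> z m by (simp add: ennreal_mult ennreal_minus[symmetric])
      finally show ?thesis .
    qed
    finally show ?thesis .
  qed
qed

text \<open>The level sets of u are disjoint, so their counts are independent, and the sum of u over
  the points is the combination of these counts with the values of u as weights. The transform thus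
  factorises into those of \<open>poisson_process_laplace_count\<close>. The level set of the value
  0 may have infinite count or mass; its weight 0 cancels it.\<close>

lemma poisson_process_laplace_simple:
  assumes PP: "poisson_process P \<Lambda> K X" and sets[measurable_cong]: "sets \<Lambda> = sets borel" and u: "simple_function borel u"
  shows "(\<integral>\<^sup>+ w. exp_neg (point_sum K X u w) \<partial>P) = exp_neg (\<integral>\<^sup>+ x. 1 - exp_neg (u x) \<partial>\<Lambda>)"
proof -
  note [measurable] = poisson_process_measurable(2,3)[OF PP]
  interpret prob_space P by (rule poisson_process_measurable(1)[OF PP])
  have fin: "finite (range u)" using simple_functionD(1)[OF u] by simp
  \<comment> \<open>The values are numbered because \<open>poisson_process\<close> grants
    independence for families indexed by finite sets of naturals.\<close>
  obtain h where h: "bij_betw h {0..<card (range u)} (range u)"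
    using ex_bij_betw_nat_finite[OF fin] by auto
  define I where "I = {0..<card (range u)}"
  define B where "B i = u -` {h i}" for i
  have fI: "finite I" by (simp add: I_def)
  have [measurable]: "u \<in> borel_measurable borel" by (rule borel_measurable_simple_function[OF u])
  have Bs[measurable]: "B i \<in> sets borel" for i
    unfolding B_def using simple_functionD(2)[OF u] by simp
  have inj: "inj_on h I" using h by (auto simp: bij_betw_def I_def)
  have disj: "disjoint_family_on B I"
    using inj by (auto simp: disjoint_family_on_def B_def inj_on_def)
  \<comment> \<open>Stated for an arbitrary F since it serves twice: the identity gives the sum over
    the points, and 1 - \<open>exp_neg\<close> gives the integrand on the intensity side.\<close>
  have decomp: "F (u x) = (\<Sum>i\<in>I. F (h i) * indicator (B i) x)" for F :: "ennreal \<Rightarrow> ennreal" and x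
  proof -
    have "u x \<in> h ` I" using h by (auto simp: bij_betw_def I_def)
    then obtain j where j: "j \<in> I" "u x = h j" by auto
    have "(\<Sum>i\<in>I. F (h i) * indicator (B i) x) = (\<Sum>i\<in>{j}. F (h i) * indicator (B i) x)"
      using j fI inj by (intro sum.mono_neutral_right) (auto simp: B_def inj_on_def indicator_def)
    then show ?thesis using j by (simp add: B_def)
  qed
  have ps: "point_sum K X u w = (\<Sum>i\<in>I. h i * point_count K X (B i) w)" for w
  proof -
    have "point_sum K X u w =
        (\<integral>\<^sup>+ i. (\<Sum>j\<in>I. h j * (if enat i < K w then indicator (B j) (X i w) else 0)) \<partial>count_space UNIV)"
      unfolding point_sum_def using decomp[of "\<lambda>x. x"] by (intro nn_integral_cong) auto
    then show ?thesis
      by (simp add: nn_integral_sum nn_integral_cmult point_count_eq point_sum_def)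
  qed
  have "indep_vars (\<lambda>_. borel) (\<lambda>i. point_count K X (B i)) I"
    using PP fI disj by (simp add: poisson_process_def)
  then have ind: "indep_vars (\<lambda>_. borel) (\<lambda>i w. exp_neg (h i * point_count K X (B i) w)) I"
    by (rule indep_vars_compose2) measurable
  have "(\<integral>\<^sup>+ w. exp_neg (point_sum K X u w) \<partial>P)
      = (\<Prod>i\<in>I. \<integral>\<^sup>+ w. exp_neg (h i * point_count K X (B i) w) \<partial>P)"
    unfolding ps exp_neg_sum[OF fI] by (rule indep_vars_nn_integral[OF fI ind]) simp
  also have "\<dots> = exp_neg (\<Sum>i\<in>I. (1 - exp_neg (h i)) * emeasure \<Lambda> (B i))"
    by (simp add: poisson_process_laplace_count[OF PP] exp_neg_sum[OF fI])
  also have "(\<Sum>i\<in>I. (1 - exp_neg (h i)) * emeasure \<Lambda> (B i))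
      = (\<integral>\<^sup>+ x. (\<Sum>i\<in>I. (1 - exp_neg (h i)) * indicator (B i) x) \<partial>\<Lambda>)"
    by (subst nn_integral_sum) (auto simp: sets nn_integral_cmult_indicator cong: measurable_cong_sets)
  also have "\<dots> = (\<integral>\<^sup>+ x. 1 - exp_neg (u x) \<partial>\<Lambda>)"
    by (simp add: decomp[of "\<lambda>x. 1 - exp_neg x", symmetric])
  finally show ?thesis .
qed

text \<open>Simple functions increase to u. On the left the transforms stay below 1, so dominated
  convergence applies on the probability space; on the right 1 - \<open>exp_neg (f i x)\<close>
  increases in i, so monotone convergence applies although \<Lambda> may be infinite.\<close>

lemma poisson_process_laplace:
  assumes PP: "poisson_process P \<Lambda> K X" and sets[measurable_cong]: "sets \<Lambda> = sets borel"
    and u[measurable]: "u \<in> borel_measurable borel"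
  shows "(\<integral>\<^sup>+ w. exp_neg (point_sum K X u w) \<partial>P) = exp_neg (\<integral>\<^sup>+ x. 1 - exp_neg (u x) \<partial>\<Lambda>)"
proof -
  note [measurable] = poisson_process_measurable(2,3)[OF PP]
  interpret prob_space P by (rule poisson_process_measurable(1)[OF PP])
  obtain f where f: "\<And>i. simple_function borel (f i)" "incseq f" "\<And>x. (SUP i. f i x) = u x"
    using borel_measurable_implies_simple_function_sequence'[OF u] by metis
  have [measurable]: "f i \<in> borel_measurable borel" for i
    by (rule borel_measurable_simple_function[OF f(1)])
  have mono: "f i x \<le> f j x" if "i \<le> j" for i j x
    using f(2) that by (auto simp: mono_def le_fun_def)
  have lim: "(\<lambda>i. f i x) \<longlonglongrightarrow> u x" for x
    unfolding f(3)[symmetric] using mono by (intro LIMSEQ_SUP) (auto simp: mono_def)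
  have lim_ps: "(\<lambda>i. point_sum K X (f i) w) \<longlonglongrightarrow> point_sum K X u w" for w
    unfolding point_sum_def
    by (rule nn_integral_LIMSEQ) (auto simp: incseq_def le_fun_def mono lim)
  have "(\<lambda>i. \<integral>\<^sup>+ w. exp_neg (point_sum K X (f i) w) \<partial>P) \<longlonglongrightarrow> (\<integral>\<^sup>+ w. exp_neg (point_sum K X u w) \<partial>P)"
    by (rule nn_integral_dominated_convergence[where w="\<lambda>_. 1"])
       (auto intro!: tendsto_exp_neg lim_ps simp: emeasure_space_1)
  moreover have "(\<lambda>i. exp_neg (\<integral>\<^sup>+ x. 1 - exp_neg (f i x) \<partial>\<Lambda>)) \<longlonglongrightarrow> exp_neg (\<integral>\<^sup>+ x. 1 - exp_neg (u x) \<partial>\<Lambda>)"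
  proof (intro tendsto_exp_neg nn_integral_LIMSEQ)
    show "incseq (\<lambda>i x. 1 - exp_neg (f i x))"
      by (auto simp: incseq_def le_fun_def intro!: ennreal_mono_minus exp_neg_antimono mono)
    show "(\<lambda>i. 1 - exp_neg (f i x)) \<longlonglongrightarrow> 1 - exp_neg (u x)" for x
      by (intro tendsto_diff_ennreal tendsto_const tendsto_exp_neg lim) auto
  qed measurable
  ultimately show ?thesis
    unfolding poisson_process_laplace_simple[OF PP sets f(1)] by (rule LIMSEQ_unique)
qed

section \<open>Laplace transforms of shot noise\<close>

text \<open>With the points held fixed, the independent marks integrate to the product of the
  numbers g (x i), where g x is the transform of one mark scaled by f x. This product is
  \<open>exp_neg\<close> of the sum of u = \<open>neg_ln\<close> \<circ> g over the points, so the
  marks have disappeared and the Laplace functional of the unmarked process applies to u.\<close>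

lemma shot_noise_law_laplace:
  assumes SN: "shot_noise_law \<Lambda> f m \<nu>" and sets: "sets \<Lambda> = sets borel"
    and f[measurable]: "f \<in> borel_measurable borel"
    and m: "prob_space m" and sm[measurable_cong]: "sets m = sets borel"
  shows "prob_space \<nu>" "sets \<nu> = sets borel"
    "(\<integral>\<^sup>+ y. exp_neg (s * y) \<partial>\<nu>) = exp_neg (\<integral>\<^sup>+ x. 1 - (\<integral>\<^sup>+ h. exp_neg (s * f x * h) \<partial>m) \<partial>\<Lambda>)"
proof -
  obtain Q :: "(enat \<times> (nat \<Rightarrow> 'a)) measure" where
    sQ[measurable_cong]: "sets Q = sets (count_space UNIV \<Otimes>\<^sub>M PiM UNIV (\<lambda>_. borel))"
    and PP: "poisson_process Q \<Lambda> fst (\<lambda>i w. snd w i)"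
    and \<nu>: "\<nu> = distr (Q \<Otimes>\<^sub>M PiM UNIV (\<lambda>_::nat. m)) borel
              (\<lambda>((K, x), h). \<Sum>i. if enat i < K then f (x i) * h i else 0)"
    using SN unfolding shot_noise_law_def by blast
  define H where "H = PiM UNIV (\<lambda>_::nat. m)"
  interpret Q: prob_space Q by (rule poisson_process_measurable(1)[OF PP])
  interpret m: prob_space m by (rule m)
  interpret HP: product_prob_space "\<lambda>_::nat. m" UNIV by unfold_locales
  have "prob_space H" unfolding H_def by unfold_locales
  then interpret H: prob_space H .
  interpret QH: pair_prob_space Q H by unfold_locales
  have [measurable_cong]: "sets H = sets (PiM UNIV (\<lambda>_::nat. borel))"
    unfolding H_def by (intro sets_PiM_cong) (auto simp: sm)
  define T where "T = (\<lambda>w. \<Sum>i. if enat i < fst (fst w) then f (snd (fst w) i) * snd w i else 0 :: ennreal)"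
  have [measurable]: "T \<in> borel_measurable (Q \<Otimes>\<^sub>M H)"
    unfolding T_def by measurable
  have \<nu>T: "\<nu> = distr (Q \<Otimes>\<^sub>M H) borel T"
    unfolding \<nu> H_def T_def by (simp add: case_prod_beta')
  show "prob_space \<nu>" unfolding \<nu>T by (rule QH.prob_space_distr) measurable
  show "sets \<nu> = sets borel" by (simp add: \<nu>T)
  define g where "g x = (\<integral>\<^sup>+ h. exp_neg (s * f x * h) \<partial>m)" for x
  have [measurable]: "g \<in> borel_measurable borel"
    unfolding g_def by measurable
  have g1: "g x \<le> 1" for x
  proof -
    have "g x \<le> (\<integral>\<^sup>+ h. 1 \<partial>m)" unfolding g_def by (intro nn_integral_mono) simp
    then show ?thesis by (simp add: m.emeasure_space_1)
  qed
  define u where "u x = neg_ln (g x)" for x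
  have [measurable]: "u \<in> borel_measurable borel" unfolding u_def by measurable
  have u: "exp_neg (u x) = g x" for x
    unfolding u_def by (rule exp_neg_neg_ln[OF g1])
  have inner: "(\<integral>\<^sup>+ h. exp_neg (s * T (q, h)) \<partial>H) = exp_neg (point_sum fst (\<lambda>i w. snd w i) u q)"
    if q: "q \<in> space Q" for q
  proof -
    obtain K x where Kx: "q = (K, x)" by (cases q)
    \<comment> \<open>Both sequences vanish beyond the number of points, so finite and infinite K
      are treated alike.\<close>
    define c where "c i = (if enat i < K then f (x i) else 0)" for i
    define v where "v i = (if enat i < K then u (x i) else 0)" for i
    have int1: "(\<integral>\<^sup>+ y. exp_neg (s * c i * y) \<partial>m) = exp_neg (v i)" for i
      by (cases "enat i < K") (auto simp: c_def v_def u g_def m.emeasure_space_1)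
    have Teq: "T (q, h) = (\<Sum>i. c i * h i)" for h
      unfolding T_def c_def Kx by (intro suminf_cong) auto
    \<comment> \<open>The product formula for integrals needs finitely many factors: restricting the
      infinite mark sequence to its first n entries gives a finite product measure, and the limit in
      n follows by dominated convergence.\<close>
    have partial: "(\<integral>\<^sup>+ h. exp_neg (s * (\<Sum>i<n. c i * h i)) \<partial>H) = exp_neg (\<Sum>i<n. v i)" for n
    proof -
      have "(\<integral>\<^sup>+ h. exp_neg (s * (\<Sum>i<n. c i * h i)) \<partial>H)
          = (\<integral>\<^sup>+ h. (\<Prod>i<n. exp_neg (s * c i * restrict h {..<n} i)) \<partial>H)"
        by (intro nn_integral_cong) (simp add: sum_distrib_left exp_neg_sum mult.assoc)
      also have "\<dots> = (\<integral>\<^sup>+ h. (\<Prod>i<n. exp_neg (s * c i * h i)) \<partial>distr H (PiM {..<n} (\<lambda>_. m)) (\<lambda>h. restrict h {..<n}))"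
        unfolding H_def by (subst nn_integral_distr) (auto intro!: borel_measurable_prod)
      also have "distr H (PiM {..<n} (\<lambda>_. m)) (\<lambda>h. restrict h {..<n}) = PiM {..<n} (\<lambda>_. m)"
        unfolding H_def by (rule HP.distr_PiM_restrict_finite) auto
      also have "(\<integral>\<^sup>+ h. (\<Prod>i<n. exp_neg (s * c i * h i)) \<partial>PiM {..<n} (\<lambda>_. m))
          = (\<Prod>i<n. \<integral>\<^sup>+ y. exp_neg (s * c i * y) \<partial>m)"
        by (rule HP.product_nn_integral_prod) auto
      finally show ?thesis by (simp add: int1 exp_neg_sum)
    qed
    have "(\<lambda>n. \<integral>\<^sup>+ h. exp_neg (s * (\<Sum>i<n. c i * h i)) \<partial>H) \<longlonglongrightarrow> (\<integral>\<^sup>+ h. exp_neg (s * T (q, h)) \<partial>H)"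
    proof (rule nn_integral_dominated_convergence[where w="\<lambda>_. 1"])
      show "AE h in H. (\<lambda>n. exp_neg (s * (\<Sum>i<n. c i * h i))) \<longlonglongrightarrow> exp_neg (s * T (q, h))"
      proof (rule AE_I2)
        fix h
        have "(\<lambda>n. (\<Sum>i<n. s * (c i * h i))) \<longlonglongrightarrow> (\<Sum>i. s * (c i * h i))"
          by (intro summable_LIMSEQ) simp
        then show "(\<lambda>n. exp_neg (s * (\<Sum>i<n. c i * h i))) \<longlonglongrightarrow> exp_neg (s * T (q, h))"
          unfolding Teq by (intro tendsto_exp_neg) (simp add: sum_distrib_left)
      qed
      show "(\<lambda>h. exp_neg (s * T (q, h))) \<in> borel_measurable H" using q by measurable
    qed (auto simp: H.emeasure_space_1)
    then have "(\<lambda>n. exp_neg (\<Sum>i<n. v i)) \<longlonglongrightarrow> (\<integral>\<^sup>+ h. exp_neg (s * T (q, h)) \<partial>H)"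
      by (simp only: partial)
    moreover have "(\<lambda>n. exp_neg (\<Sum>i<n. v i)) \<longlonglongrightarrow> exp_neg (\<Sum>i. v i)"
      by (intro tendsto_exp_neg summable_LIMSEQ) simp
    moreover have "point_sum fst (\<lambda>i w. snd w i) u q = (\<Sum>i. v i)"
      by (simp only: point_sum_def nn_integral_count_space_nat v_def Kx fst_conv snd_conv)
    ultimately show ?thesis by (simp only: LIMSEQ_unique)
  qed
  have "(\<integral>\<^sup>+ y. exp_neg (s * y) \<partial>\<nu>) = (\<integral>\<^sup>+ w. exp_neg (s * T w) \<partial>(Q \<Otimes>\<^sub>M H))"
    unfolding \<nu>T by (subst nn_integral_distr) auto
  also have "\<dots> = (\<integral>\<^sup>+ q. \<integral>\<^sup>+ h. exp_neg (s * T (q, h)) \<partial>H \<partial>Q)"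
    by (subst H.nn_integral_fst) auto
  also have "\<dots> = (\<integral>\<^sup>+ q. exp_neg (point_sum fst (\<lambda>i w. snd w i) u q) \<partial>Q)"
    by (intro nn_integral_cong inner)
  also have "\<dots> = exp_neg (\<integral>\<^sup>+ x. 1 - g x \<partial>\<Lambda>)"
    by (subst poisson_process_laplace[OF PP sets]) (auto simp: u)
  finally show "(\<integral>\<^sup>+ y. exp_neg (s * y) \<partial>\<nu>) = exp_neg (\<integral>\<^sup>+ x. 1 - (\<integral>\<^sup>+ h. exp_neg (s * f x * h) \<partial>m) \<partial>\<Lambda>)"
    unfolding g_def .
qed

section \<open>Exponential and gamma laws\<close>

lemma sets_real_law_on [measurable_cong, simp]: "sets (real_law_on A f) = sets borel"
  and space_real_law_on [simp]: "space (real_law_on A f) = UNIV"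
  by (simp_all add: real_law_on_def)

lemma sets_nonneg_law [measurable_cong, simp]: "sets (nonneg_law f) = sets borel"
  and space_nonneg_law [simp]: "space (nonneg_law f) = UNIV"
  by (simp_all add: nonneg_law_def)

lemma sets_exp_law [measurable_cong, simp]: "sets (exp_law \<sigma>) = sets borel"
  and sets_gamma_law [measurable_cong, simp]: "sets (gamma_law m) = sets borel"
  by (simp_all add: exp_law_def gamma_law_def)

lemma nn_integral_real_law_on:
  assumes [measurable]: "f \<in> borel_measurable borel" "A \<in> sets borel" "g \<in> borel_measurable borel"
  shows "(\<integral>\<^sup>+ x. g x \<partial>real_law_on A f) = (\<integral>\<^sup>+ x. ennreal (f x) * indicator A x * g x \<partial>lborel)"
  unfolding real_law_on_def by (subst nn_integral_density) auto

lemma nn_integral_nonneg_law: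
  assumes [measurable]: "f \<in> borel_measurable borel" "g \<in> borel_measurable borel"
  shows "(\<integral>\<^sup>+ y. g y \<partial>nonneg_law f) = (\<integral>\<^sup>+ x. ennreal (f x) * indicator {0..} x * g (ennreal x) \<partial>lborel)"
  unfolding nonneg_law_def
  by (subst nn_integral_distr) (auto simp: nn_integral_real_law_on)

lemma nn_integral_exp_atLeast:
  assumes "0 \<le> b" "0 < c"
  shows "(\<integral>\<^sup>+ x. ennreal (b * exp (- (c * x))) * indicator {a..} x \<partial>lborel) = ennreal (b / c * exp (- (c * a)))"
proof -
  have "((\<lambda>x. - (b / c) * exp (- (c * x))) \<longlongrightarrow> - (b / c) * 0) at_top"
    using assms by (intro tendsto_mult tendsto_const exp_at_bot[THEN filterlim_compose])
      (auto simp: filterlim_uminus_at_bot intro!: filterlim_tendsto_pos_mult_at_top[OF tendsto_const] filterlim_ident)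
  then have "(\<integral>\<^sup>+ x. ennreal (b * exp (- (c * x))) * indicator {a..} x \<partial>lborel) = - (b / c) * 0 - - (b / c) * exp (- (c * a))"
    using assms by (intro nn_integral_FTC_atLeast) (auto intro!: derivative_eq_intros)
  then show ?thesis by simp
qed

lemma nn_integral_exp_law:
  assumes "\<sigma> > 0" and [measurable]: "g \<in> borel_measurable borel"
  shows "(\<integral>\<^sup>+ y. g y \<partial>exp_law \<sigma>) = (\<integral>\<^sup>+ x. ennreal (1 / \<sigma> * exp (- (1 / \<sigma> * x))) * indicator {0..} x * g (ennreal x) \<partial>lborel)"
  unfolding exp_law_def
  by (subst nn_integral_nonneg_law)
     (auto simp: exponential_density_def mult.commute intro!: nn_integral_cong split: split_indicator)

lemma laplace_exp_law:
  assumes "\<sigma> > 0" "s \<ge> 0"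
  shows "(\<integral>\<^sup>+ y. exp_neg (ennreal s * y) \<partial>exp_law \<sigma>) = ennreal (1 / (1 + s * \<sigma>))"
proof -
  have "(\<integral>\<^sup>+ y. exp_neg (ennreal s * y) \<partial>exp_law \<sigma>)
      = (\<integral>\<^sup>+ x. ennreal (1 / \<sigma> * exp (- ((1 / \<sigma> + s) * x))) * indicator {0..} x \<partial>lborel)"
    using assms
    by (subst nn_integral_exp_law)
       (auto intro!: nn_integral_cong split: split_indicator
         simp: exp_neg_ennreal algebra_simps exp_add[symmetric] simp flip: ennreal_mult)
  also have "\<dots> = ennreal (1 / \<sigma> / (1 / \<sigma> + s) * exp (- ((1 / \<sigma> + s) * 0)))"
    using assms by (intro nn_integral_exp_atLeast) (auto intro: add_pos_nonneg)
  also have "1 / \<sigma> / (1 / \<sigma> + s) * exp (- ((1 / \<sigma> + s) * 0)) = 1 / (1 + s * \<sigma>)"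
    using assms by (simp add: field_simps)
  finally show ?thesis .
qed

lemma prob_space_exp_law: "\<sigma> > 0 \<Longrightarrow> prob_space (exp_law \<sigma>)"
  using laplace_exp_law[of \<sigma> 0] by (intro prob_spaceI) simp

text \<open>The event says that the exponential variable exceeds \<phi> D / c, which has probability
  exp (- \<phi> D / (c \<sigma>)). Positivity of \<phi> matters when D = \<infinity>: the quotient
  is 0 there and both sides vanish, whereas \<phi> = 0 would make the right side 1.\<close>

lemma emeasure_exp_law_ratio:
  assumes "\<sigma> > 0" "0 < \<phi>" "0 < c" "0 < D"
  shows "emeasure (exp_law \<sigma>) {h. ennreal \<phi> < ennreal c * h / D} = exp_neg (ennreal (\<phi> / (c * \<sigma>)) * D)"
proof (cases D)
  case top
  with assms show ?thesis by (simp add: ennreal_mult_top)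
next
  case (real d)
  with assms have d: "d > 0" by simp
  have "emeasure (exp_law \<sigma>) {h. ennreal \<phi> < ennreal c * h / D}
      = (\<integral>\<^sup>+ h. indicator {h. ennreal \<phi> < ennreal c * h / D} h \<partial>exp_law \<sigma>)"
    by (subst nn_integral_indicator) auto
  also have "\<dots> = (\<integral>\<^sup>+ x. ennreal (1 / \<sigma> * exp (- (1 / \<sigma> * x))) * indicator {0..} x *
      indicator {h. ennreal \<phi> < ennreal c * h / D} (ennreal x) \<partial>lborel)"
    using assms by (subst nn_integral_exp_law) auto
  also have "\<dots> = (\<integral>\<^sup>+ x. ennreal (1 / \<sigma> * exp (- (1 / \<sigma> * x))) * indicator {\<phi> * d / c..} x \<partial>lborel)"
  proof (rule nn_integral_cong_AE)
    \<comment> \<open>The event is an open half-line and the integral formula uses the closed one;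
      they differ in this single point.\<close>
    have "AE x in lborel. x \<noteq> \<phi> * d / c" by (rule AE_lborel_singleton)
    then show "AE x in lborel. ennreal (1 / \<sigma> * exp (- (1 / \<sigma> * x))) * indicator {0..} x *
        indicator {h. ennreal \<phi> < ennreal c * h / D} (ennreal x) =
        ennreal (1 / \<sigma> * exp (- (1 / \<sigma> * x))) * indicator {\<phi> * d / c..} x"
    proof eventually_elim
      case (elim x)
      have "0 \<le> \<phi> * d / c" using assms d by simp
      moreover have "ennreal \<phi> < ennreal c * ennreal x / D \<longleftrightarrow> \<phi> * d / c < x" if "x \<ge> 0"
        using that assms d real
        by (simp add: divide_ennreal ennreal_less_iff field_simps flip: ennreal_mult)
      ultimately show ?case using elim by (auto split: split_indicator)
    qed
  qed
  also have "\<dots> = ennreal (1 / \<sigma> / (1 / \<sigma>) * exp (- (1 / \<sigma> * (\<phi> * d / c))))"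
    using assms by (intro nn_integral_exp_atLeast) auto
  also have "\<dots> = ennreal (exp (- (\<phi> / (c * \<sigma>) * d)))"
    using assms by (simp add: mult.commute)
  also have "\<dots> = exp_neg (ennreal (\<phi> / (c * \<sigma>) * d))"
    using assms d by (intro exp_neg_ennreal[symmetric]) simp
  also have "ennreal (\<phi> / (c * \<sigma>) * d) = ennreal (\<phi> / (c * \<sigma>)) * D"
    unfolding real(2) using assms d by (intro ennreal_mult) auto
  finally show ?thesis .
qed

text \<open>Substituting t = c x in Euler's integral for Gamma m produces the factor c powr m.
  Dividing by this positive finite number is legitimate before the integral is known to be
  finite.\<close>

lemma nn_integral_gamma:
  assumes "m > 0" "c > 0"
  shows "(\<integral>\<^sup>+ x. ennreal (x powr (m - 1) * exp (- (c * x))) * indicator {0..} x \<partial>lborel)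
    = ennreal (Gamma m / c powr m)"
proof -
  let ?J = "\<integral>\<^sup>+ x. ennreal (x powr (m - 1) * exp (- (c * x))) * indicator {0..} x \<partial>lborel"
  have "ennreal (Gamma m) = (\<integral>\<^sup>+ t. ennreal (indicator {0..} t * t powr (m - 1) / exp t) \<partial>lborel)"
    using assms by (simp add: Gamma_conv_nn_integral_real)
  also have "\<dots> = ennreal c * (\<integral>\<^sup>+ x. ennreal (indicator {0..} (0 + c * x) * (0 + c * x) powr (m - 1) / exp (0 + c * x)) \<partial>lborel)"
    using assms by (subst nn_integral_real_affine[where c=c and t=0]) auto
  also have "(\<integral>\<^sup>+ x. ennreal (indicator {0..} (0 + c * x) * (0 + c * x) powr (m - 1) / exp (0 + c * x)) \<partial>lborel)
      = (\<integral>\<^sup>+ x. ennreal (c powr (m - 1)) * (ennreal (x powr (m - 1) * exp (- (c * x))) * indicator {0..} x) \<partial>lborel)"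
    using assms
    by (intro nn_integral_cong)
       (auto split: split_indicator simp: powr_mult exp_minus field_simps zero_le_mult_iff simp flip: ennreal_mult)
  also have "\<dots> = ennreal (c powr (m - 1)) * ?J"
    by (intro nn_integral_cmult) measurable
  also have "ennreal c * (ennreal (c powr (m - 1)) * ?J) = ennreal (c powr m) * ?J"
    using assms by (simp add: powr_diff mult.assoc[symmetric] flip: ennreal_mult)
  finally have "ennreal (Gamma m) / ennreal (c powr m) = ennreal (c powr m) * ?J / ennreal (c powr m)"
    by simp
  also have "\<dots> = ?J"
    using assms by (simp add: ennreal_mult_divide_eq mult.commute[of _ ?J])
  finally show ?thesis
    using assms Gamma_real_pos[of m] by (simp add: divide_ennreal)
qed

text \<open>Tilting by exp (- s x) changes the rate from m to m + s, and the ratio of the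
  normalising constants is (m / (m + s)) powr m.\<close>

lemma laplace_gamma_law:
  assumes "m > 0" "s \<ge> 0"
  shows "(\<integral>\<^sup>+ y. exp_neg (ennreal s * y) \<partial>gamma_law m) = ennreal ((1 + s / m) powr (- m))"
proof -
  have G: "Gamma m > 0" using assms by (simp add: Gamma_real_pos)
  have "(\<integral>\<^sup>+ y. exp_neg (ennreal s * y) \<partial>gamma_law m)
      = (\<integral>\<^sup>+ x. ennreal (m powr m / Gamma m) *
          (ennreal (x powr (m - 1) * exp (- ((m + s) * x))) * indicator {0..} x) \<partial>lborel)"
    using assms G unfolding gamma_law_def
    by (subst nn_integral_nonneg_law)
       (auto intro!: nn_integral_cong split: split_indicator
         simp: exp_neg_ennreal algebra_simps exp_add[symmetric] simp flip: ennreal_mult)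
  also have "\<dots> = ennreal (m powr m / Gamma m) * ennreal (Gamma m / (m + s) powr m)"
    using assms by (subst nn_integral_cmult) (auto simp: nn_integral_gamma)
  also have "\<dots> = ennreal (m powr m / (m + s) powr m)"
    using G by (simp flip: ennreal_mult)
  also have "m powr m / (m + s) powr m = (1 + s / m) powr (- m)"
  proof -
    have "1 + s / m = (m + s) / m" using assms by (simp add: field_simps)
    then show ?thesis using assms by (simp add: powr_minus powr_divide field_simps)
  qed
  finally show ?thesis .
qed

lemma prob_space_gamma_law: "m > 0 \<Longrightarrow> prob_space (gamma_law m)"
  using laplace_gamma_law[of m 0] by (intro prob_spaceI) (simp add: gamma_law_def)

section \<open>Polar coordinates in the plane\<close>

text \<open>The half-lines {..r} form a generator closed under intersection, so it suffices that a
  disc of radius r has area pi r^2, which is the integral of 2 pi x over [0, r]. This is the radial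
  part of polar coordinates.\<close>

lemma distr_norm_real2:
  "distr lborel borel (norm :: real^2 \<Rightarrow> real) = density lborel (\<lambda>r. ennreal (2 * pi * r) * indicator {0..} r)"
proof (rule measure_eqI_generator_eq[where E="range atMost" and \<Omega>=UNIV and A="\<lambda>i. {..real i}"])
  show "Int_stable (range (atMost :: real \<Rightarrow> _))"
    by (auto simp: Int_stable_def)
  have ball: "emeasure (distr lborel borel (norm :: real^2 \<Rightarrow> real)) {..r} = ennreal (pi * (max 0 r)\<^sup>2)" for r
  proof -
    have "norm -` {..r} = (cball 0 r :: (real^2) set)" by auto
    then have "emeasure (distr lborel borel (norm :: real^2 \<Rightarrow> real)) {..r} = emeasure lborel (cball 0 r :: (real^2) set)"
      by (simp add: emeasure_distr)
    also have "\<dots> = ennreal (pi * (max 0 r)\<^sup>2)"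
      by (cases "r < 0") (auto simp: emeasure_cball unit_ball_vol_2 not_less max_absorb2)
    finally show ?thesis .
  qed
  then show "emeasure (distr lborel borel (norm :: real^2 \<Rightarrow> real)) {..real i} \<noteq> \<infinity>" for i by simp
  show "(\<Union>i. {..real i}) = UNIV" using real_arch_simple by auto
  show "sets (distr lborel borel norm) = sigma_sets UNIV (range (atMost :: real \<Rightarrow> _))"
    by (simp add: borel_eq_atMost)
  show "sets (density lborel (\<lambda>r. ennreal (2 * pi * r) * indicator {0..} r)) = sigma_sets UNIV (range (atMost :: real \<Rightarrow> _))"
    using borel_eq_atMost[where 'a=real] by (simp add: borel_eq_atMost)
  fix X assume "X \<in> range (atMost :: real \<Rightarrow> _)"
  then obtain r where X: "X = {..r}" by auto
  have "emeasure (density lborel (\<lambda>r. ennreal (2 * pi * r) * indicator {0..} r)) X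
      = (\<integral>\<^sup>+ x. ennreal (2 * pi * x) * indicator {0..} x * indicator {..r} x \<partial>lborel)"
    unfolding X by (subst emeasure_density) auto
  \<comment> \<open>Writing max 0 r treats negative r together with the rest: the interval then
    shrinks to the null set {0}.\<close>
  also have "\<dots> = (\<integral>\<^sup>+ x. ennreal (2 * pi * x) * indicator {0..max 0 r} x \<partial>lborel)"
    by (rule nn_integral_cong_AE)
       (use AE_lborel_singleton[of 0] in eventually_elim, auto split: split_indicator)
  also have "\<dots> = ennreal (pi * (max 0 r)\<^sup>2 - pi * 0\<^sup>2)"
    by (rule nn_integral_FTC_Icc) (auto intro!: derivative_eq_intros)
  finally show "emeasure (distr lborel borel (norm :: real^2 \<Rightarrow> real)) X
      = emeasure (density lborel (\<lambda>r. ennreal (2 * pi * r) * indicator {0..} r)) X"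
    using ball[of r] by (simp add: X)
qed auto

lemma sets_outer_intensity [simp]: "sets (outer_intensity R g) = sets borel"
  by (simp add: outer_intensity_def)

text \<open>Rotation invariance of intensity and integrand leaves an integral over the radius. The
  intensity charges only |x| > R while the radial integral runs over r \<ge> R; the boundary radius
  is a null set.\<close>

lemma nn_integral_outer_intensity:
  assumes [measurable]: "g \<in> borel_measurable borel" "G \<in> borel_measurable borel" and R: "0 \<le> R"
  shows "(\<integral>\<^sup>+ x. G (norm x) \<partial>outer_intensity R g)
    = (\<integral>\<^sup>+ r. ennreal (g r) * ennreal (2 * pi * r) * G r * indicator {R..} r \<partial>lborel)"
proof -
  have "(\<integral>\<^sup>+ x. G (norm x) \<partial>outer_intensity R g)
      = (\<integral>\<^sup>+ x. ennreal (g (norm x)) * indicator {R<..} (norm x) * G (norm x) \<partial>(lborel :: (real^2) measure))"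
    unfolding outer_intensity_def
    by (subst nn_integral_density) (auto intro!: nn_integral_cong split: split_indicator)
  also have "\<dots> = (\<integral>\<^sup>+ r. ennreal (g r) * indicator {R<..} r * G r \<partial>distr lborel borel (norm :: real^2 \<Rightarrow> real))"
    by (subst nn_integral_distr) auto
  also have "\<dots> = (\<integral>\<^sup>+ r. ennreal (2 * pi * r) * indicator {0..} r * (ennreal (g r) * indicator {R<..} r * G r) \<partial>lborel)"
    unfolding distr_norm_real2 by (subst nn_integral_density) auto
  also have "\<dots> = (\<integral>\<^sup>+ r. ennreal (g r) * ennreal (2 * pi * r) * G r * indicator {R..} r \<partial>lborel)"
  proof (rule nn_integral_cong_AE)
    show "AE r in lborel. ennreal (2 * pi * r) * indicator {0..} r * (ennreal (g r) * indicator {R<..} r * G r)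
        = ennreal (g r) * ennreal (2 * pi * r) * G r * indicator {R..} r"
      using AE_lborel_singleton[of R]
    proof eventually_elim
      case (elim r)
      then show ?case using R by (cases "R < r") (auto simp: mult_ac)
    qed
  qed
  finally show ?thesis .
qed

section \<open>Distance densities and mixtures\<close>

text \<open>The function is the probability that a Poisson variable of mean u is at most k, which is
  the tail of the Erlang law of shape k + 1. In its derivative all terms but the last cancel, which
  gives an explicit antiderivative for the distance densities.\<close>

lemma DERIV_erlang_tail:
  "((\<lambda>u. (\<Sum>j\<le>k. u ^ j / fact j) * exp (- u)) has_real_derivative - (u ^ k / fact k * exp (- u))) (at u)"
proof (induction k)
  case 0
  show ?case by (auto intro!: derivative_eq_intros)
next
  case (Suc k)
  have "((\<lambda>u. u ^ Suc k / fact (Suc k)) has_real_derivative real (Suc k) * u ^ k / fact (Suc k)) (at u)"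
    using DERIV_cdivide[OF DERIV_pow[of "Suc k" u UNIV], of "fact (Suc k)"] by simp
  also have "real (Suc k) * u ^ k / fact (Suc k) = u ^ k / fact k"
    by (subst fact_Suc) (simp del: of_nat_Suc)
  finally have "((\<lambda>u. u ^ Suc k / fact (Suc k) * exp (- u)) has_real_derivative
      (u ^ k / fact k * exp (- u) + - exp (- u) * (u ^ Suc k / fact (Suc k)))) (at u)"
    by (rule DERIV_mult) (auto intro!: derivative_eq_intros)
  from DERIV_add[OF Suc.IH this] show ?case
    by (simp add: algebra_simps del: fact_Suc power_Suc)
qed

lemma tendsto_erlang_tail: "((\<lambda>u::real. (\<Sum>j\<le>k. u ^ j / fact j) * exp (- u)) \<longlongrightarrow> 0) at_top"
proof -
  have "((\<lambda>u::real. \<Sum>j\<le>k. (u ^ j / exp u) / fact j) \<longlongrightarrow> (\<Sum>j\<le>k. 0 / fact j)) at_top"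
    by (intro tendsto_sum tendsto_divide tendsto_power_div_exp_0 tendsto_const) auto
  then show ?thesis
    unfolding sum_distrib_right by (simp add: exp_minus divide_inverse mult_ac)
qed

text \<open>In the variable u = lam_BS pi (r^2 - r1^2), the mean number of base stations in the
  annulus between the two radii, the density is the Erlang density of shape n - 1 times du/dr. Its
  antiderivative is minus the Erlang tail, which tends to 0 at infinity and equals -1 at r1.\<close>

lemma nn_integral_nth_nearest_pdf:
  assumes lam: "lam_BS p > 0" and r1: "0 \<le> r1" and n: "n \<ge> 2"
  shows "(\<integral>\<^sup>+ r. ennreal (nth_nearest_pdf p n r1 r) * indicator {r1..} r \<partial>lborel) = 1" (is "?lhs = 1")
proof -
  define k where "k = n - 2"
  define L where "L = lam_BS p * pi"
  have L: "L > 0" using lam by (simp add: L_def)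
  define u where "u r = L * (r\<^sup>2 - r1\<^sup>2)" for r
  define F where "F r = - ((\<Sum>j\<le>k. u r ^ j / fact j) * exp (- u r))" for r
  have n1: "n - 1 = Suc k" using n by (simp add: k_def)
  have pdf: "nth_nearest_pdf p n r1 r = u r ^ k / fact k * exp (- u r) * (L * (2 * r))" for r
    unfolding nth_nearest_pdf_def n1 k_def[symmetric] u_def L_def[symmetric]
    by (simp add: power_mult_distrib L_def)
  have "?lhs = 0 - F r1"
  proof (rule nn_integral_FTC_atLeast)
    show "nth_nearest_pdf p n r1 \<in> borel_measurable borel"
      unfolding nth_nearest_pdf_def[abs_def] by measurable
    show "DERIV F r :> nth_nearest_pdf p n r1 r" for r
    proof -
      have "(u has_real_derivative L * (2 * r)) (at r)"
        unfolding u_def by (auto intro!: derivative_eq_intros)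
      from DERIV_minus[OF DERIV_chain2[OF DERIV_erlang_tail this]] show ?thesis
        unfolding F_def[abs_def] pdf by (simp add: mult_ac)
    qed
    show "0 \<le> nth_nearest_pdf p n r1 r" if "r1 \<le> r" for r
    proof -
      have "r1\<^sup>2 \<le> r\<^sup>2" using that r1 by (intro power_mono) auto
      then show ?thesis using that r1 L by (auto simp: pdf u_def)
    qed
    have "filterlim u at_top at_top"
    proof -
      have "filterlim (\<lambda>r. - (L * r1\<^sup>2) + L * r ^ 2) at_top at_top"
        using L by (intro filterlim_tendsto_add_at_top[OF tendsto_const]
          filterlim_tendsto_pos_mult_at_top[OF tendsto_const] filterlim_pow_at_top filterlim_ident) auto
      then show ?thesis unfolding u_def[abs_def] by (simp add: algebra_simps)
    qed
    from tendsto_minus[OF filterlim_compose[OF tendsto_erlang_tail this]]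
    show "(F \<longlongrightarrow> 0) at_top" unfolding F_def[abs_def] by simp
  qed
  also have "F r1 = - 1"
  proof -
    \<comment> \<open>At u = 0 only the term j = 0 survives, with 0 ^ 0 = 1.\<close>
    have "(\<Sum>j\<le>k. (0::real) ^ j / fact j) = (\<Sum>j\<in>{0}. 0 ^ j / fact j)"
      by (intro sum.mono_neutral_right) auto
    then show ?thesis by (simp add: F_def u_def)
  qed
  finally show ?thesis by simp
qed

text \<open>Together with \<open>nearest_pdf_eq\<close> this makes the two other distance densities
  instances of the nth nearest one with n = 2, so a single normalisation serves all three.\<close>

lemma interferer_pdf_eq: "interferer_pdf p r1 = nth_nearest_pdf p 2 r1"
  by (simp add: fun_eq_iff interferer_pdf_def nth_nearest_pdf_def mult_ac)

lemma nearest_pdf_eq: "nearest_pdf p = nth_nearest_pdf p 2 0"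
  by (simp add: fun_eq_iff nearest_pdf_def nth_nearest_pdf_def mult_ac)

lemma measurable_nth_nearest_pdf [measurable]: "nth_nearest_pdf p n r1 \<in> borel_measurable borel"
  unfolding nth_nearest_pdf_def[abs_def] by measurable

section \<open>Integration against laws with densities and against mixtures\<close>

lemma prob_space_real_law_on:
  assumes "f \<in> borel_measurable borel" "A \<in> sets borel" "(\<integral>\<^sup>+ x. ennreal (f x) * indicator A x \<partial>lborel) = 1"
  shows "prob_space (real_law_on A f)"
  using nn_integral_real_law_on[OF assms(1,2), of "\<lambda>_. 1"] assms(3) by (intro prob_spaceI) simp

lemma AE_real_law_on:
  assumes [measurable]: "f \<in> borel_measurable borel" "A \<in> sets borel"
  assumes "AE x in real_law_on A f. Q x"
  shows "AE x in lborel. x \<in> A \<longrightarrow> 0 < f x \<longrightarrow> Q x"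
proof -
  have "AE x in lborel. 0 < ennreal (f x) * indicator A x \<longrightarrow> Q x"
    using assms(3) unfolding real_law_on_def by (subst (asm) AE_density) auto
  then show ?thesis by eventually_elim (auto simp: ennreal_zero_less_mult_iff split: split_indicator)
qed

lemma sets_angle_law [measurable_cong, simp]: "sets angle_law = sets borel"
  by (simp add: angle_law_def)

lemma prob_space_angle_law: "prob_space angle_law"
  unfolding angle_law_def by (rule prob_space_uniform_measure) auto

lemma AE_angle_law: "(AE b in angle_law. Q b) \<longleftrightarrow> (AE b in lborel. b \<in> {0..pi} \<longrightarrow> Q b)"
  unfolding angle_law_def by (rule AE_uniform_measure) auto

lemma nn_integral_angle_law:
  assumes "g \<in> borel_measurable borel"
  shows "(\<integral>\<^sup>+ b. g b \<partial>angle_law) = (\<integral>\<^sup>+ b. g b * indicator {0..pi} b \<partial>lborel) / ennreal pi"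
  unfolding angle_law_def using assms by (subst nn_integral_uniform_measure) auto

text \<open>Hides the kernel and keeps only the function g of its integrals: g is measurable as an
  integral against a kernel, and almost every value of g comes from a measure satisfying the
  relation. The computation of integrals uses no more of the kernel than this.\<close>

lemma mixture_law_integral:
  assumes mix: "mixture_law M N C \<mu>" and M: "prob_space M" and F[measurable]: "F \<in> borel_measurable N"
  obtains g where "g \<in> borel_measurable M" "AE z in M. \<exists>\<nu>. C z \<nu> \<and> g z = (\<integral>\<^sup>+ x. F x \<partial>\<nu>)"
    "(\<integral>\<^sup>+ x. F x \<partial>\<mu>) = (\<integral>\<^sup>+ z. g z \<partial>M)"
proof -
  obtain \<kappa> where \<kappa>: "\<kappa> \<in> measurable M (prob_algebra N)" "AE z in M. C z (\<kappa> z)" "\<mu> = bind M \<kappa>"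
    using mix unfolding mixture_law_def by blast
  have \<kappa>s[measurable]: "\<kappa> \<in> measurable M (subprob_algebra N)"
    by (rule measurable_prob_algebraD[OF \<kappa>(1)])
  let ?g = "\<lambda>z. \<integral>\<^sup>+ x. F x \<partial>\<kappa> z"
  have "?g \<in> borel_measurable M"
    by (rule measurable_compose[OF \<kappa>s nn_integral_measurable_subprob_algebra[OF F]])
  moreover have "AE z in M. \<exists>\<nu>. C z \<nu> \<and> ?g z = (\<integral>\<^sup>+ x. F x \<partial>\<nu>)"
    using \<kappa>(2) by (rule eventually_mono) (blast intro: refl)
  moreover have "(\<integral>\<^sup>+ x. F x \<partial>\<mu>) = (\<integral>\<^sup>+ z. ?g z \<partial>M)"
    unfolding \<kappa>(3) by (rule nn_integral_bind[OF F \<kappa>s])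
  ultimately show thesis by (rule that)
qed

lemma mixture_law_prob_space:
  assumes mix: "mixture_law M N C \<mu>" and M: "prob_space M"
  shows "prob_space \<mu>" "sets \<mu> = sets N"
proof -
  interpret prob_space M by (rule M)
  obtain \<kappa> where \<kappa>: "\<kappa> \<in> measurable M (prob_algebra N)" "\<mu> = bind M \<kappa>"
    using mix unfolding mixture_law_def by blast
  have \<kappa>s: "\<kappa> \<in> measurable M (subprob_algebra N)"
    by (rule measurable_prob_algebraD[OF \<kappa>(1)])
  have "prob_space (\<kappa> z)" if "z \<in> space M" for z
    using measurable_space[OF \<kappa>(1) that] by (simp add: space_prob_algebra)
  then have "AE z in M. prob_space (\<kappa> z)" by (rule AE_I2)
  then show "prob_space \<mu>"
    unfolding \<kappa>(2) by (rule prob_space_bind[OF _ \<kappa>s])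
  show "sets \<mu> = sets N"
    unfolding \<kappa>(2) by (rule sets_bind[OF sets_kernel[OF \<kappa>s]]) (auto simp: not_empty)
qed

text \<open>The integrals are taken of the measurable g; the closed formula \<Phi> has only to agree
  with g almost everywhere on the part of A where f is positive, since values f x \<le> 0 become 0
  in ennreal.\<close>

lemma mixture_law_real:
  assumes mix: "mixture_law (real_law_on A f) N C \<mu>"
    and f[measurable]: "f \<in> borel_measurable borel" and A[measurable]: "A \<in> sets borel"
    and one: "(\<integral>\<^sup>+ x. ennreal (f x) * indicator A x \<partial>lborel) = 1"
    and F: "F \<in> borel_measurable N"
    and C: "AE x in lborel. \<forall>\<nu>. x \<in> A \<longrightarrow> C x \<nu> \<longrightarrow> (\<integral>\<^sup>+ y. F y \<partial>\<nu>) = \<Phi> x"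
  shows "(\<integral>\<^sup>+ y. F y \<partial>\<mu>) = (\<integral>\<^sup>+ x\<in>A. \<Phi> x * ennreal (f x) \<partial>lborel)"
proof -
  note M = prob_space_real_law_on[OF f A one]
  obtain g where g: "g \<in> borel_measurable (real_law_on A f)"
      "AE z in real_law_on A f. \<exists>\<nu>. C z \<nu> \<and> g z = (\<integral>\<^sup>+ x. F x \<partial>\<nu>)"
      "(\<integral>\<^sup>+ x. F x \<partial>\<mu>) = (\<integral>\<^sup>+ z. g z \<partial>real_law_on A f)"
    using mixture_law_integral[OF mix M F] .
  have [measurable]: "g \<in> borel_measurable borel"
    using g(1) by simp
  have "(\<integral>\<^sup>+ z. g z \<partial>real_law_on A f) = (\<integral>\<^sup>+ x. ennreal (f x) * indicator A x * g x \<partial>lborel)"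
    by (rule nn_integral_real_law_on) measurable
  also have "\<dots> = (\<integral>\<^sup>+ x\<in>A. \<Phi> x * ennreal (f x) \<partial>lborel)"
  proof (rule nn_integral_cong_AE)
    show "AE x in lborel. ennreal (f x) * indicator A x * g x = \<Phi> x * ennreal (f x) * indicator A x"
      using AE_real_law_on[OF f A g(2)] C
    proof eventually_elim
      case (elim x)
      show ?case
      proof (cases "x \<in> A \<and> 0 < f x")
        case True
        with elim show ?thesis by (auto simp: mult_ac)
      qed (auto simp: ennreal_neg split: split_indicator)
    qed
  qed
  finally show ?thesis using g(3) by simp
qed

text \<open>Fubini is applied to the measurable g on the product, and g is exchanged for \<Phi> only
  afterwards, inside the iterated integrals; hence the nested almost-everywhere hypothesis. The
  uniform density 1 / pi is kept next to f, the form in which \<open>P_B\<close> displays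
  it.\<close>

lemma mixture_law_real_angle:
  assumes mix: "mixture_law (real_law_on A f \<Otimes>\<^sub>M angle_law) N C \<mu>"
    and f[measurable]: "f \<in> borel_measurable borel" and A[measurable]: "A \<in> sets borel"
    and one: "(\<integral>\<^sup>+ x. ennreal (f x) * indicator A x \<partial>lborel) = 1"
    and F: "F \<in> borel_measurable N"
    and C: "AE x in lborel. AE b in lborel. \<forall>\<nu>. x \<in> A \<longrightarrow> b \<in> {0..pi} \<longrightarrow> C (x, b) \<nu> \<longrightarrow> (\<integral>\<^sup>+ y. F y \<partial>\<nu>) = \<Phi> x b"
  shows "prob_space \<mu>" "sets \<mu> = sets N"
    "(\<integral>\<^sup>+ y. F y \<partial>\<mu>) = (\<integral>\<^sup>+ x\<in>A. (\<integral>\<^sup>+ b\<in>{0..pi}. \<Phi> x b * ennreal (f x * (1 / pi)) \<partial>lborel) \<partial>lborel)"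
proof -
  interpret M1: prob_space "real_law_on A f" by (rule prob_space_real_law_on[OF f A one])
  interpret M2: prob_space angle_law by (rule prob_space_angle_law)
  interpret pair_prob_space "real_law_on A f" angle_law by unfold_locales
  let ?M = "real_law_on A f \<Otimes>\<^sub>M angle_law"
  have M: "prob_space ?M" by unfold_locales
  show "prob_space \<mu>" "sets \<mu> = sets N"
    by (rule mixture_law_prob_space[OF mix M])+
  obtain g where g: "g \<in> borel_measurable ?M"
      "AE z in ?M. \<exists>\<nu>. C z \<nu> \<and> g z = (\<integral>\<^sup>+ x. F x \<partial>\<nu>)"
      "(\<integral>\<^sup>+ x. F x \<partial>\<mu>) = (\<integral>\<^sup>+ z. g z \<partial>?M)"
    using mixture_law_integral[OF mix M F] .
  have [measurable]: "g \<in> borel_measurable (borel \<Otimes>\<^sub>M borel)"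
    using g(1) by measurable
  have "(\<integral>\<^sup>+ z. g z \<partial>?M) = (\<integral>\<^sup>+ x. (\<integral>\<^sup>+ b. g (x, b) \<partial>angle_law) \<partial>real_law_on A f)"
    by (rule M2.nn_integral_fst[symmetric]) measurable
  also have "\<dots> = (\<integral>\<^sup>+ x. ennreal (f x) * indicator A x * (\<integral>\<^sup>+ b. g (x, b) \<partial>angle_law) \<partial>lborel)"
    by (rule nn_integral_real_law_on) measurable
  also have "\<dots> = (\<integral>\<^sup>+ x\<in>A. (\<integral>\<^sup>+ b\<in>{0..pi}. \<Phi> x b * ennreal (f x * (1 / pi)) \<partial>lborel) \<partial>lborel)"
  proof (rule nn_integral_cong_AE)
    show "AE x in lborel. ennreal (f x) * indicator A x * (\<integral>\<^sup>+ b. g (x, b) \<partial>angle_law)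
        = (\<integral>\<^sup>+ b\<in>{0..pi}. \<Phi> x b * ennreal (f x * (1 / pi)) \<partial>lborel) * indicator A x"
      using AE_real_law_on[OF f A AE_pair[OF g(2)]] C
    proof eventually_elim
      case (elim x)
      show ?case
      proof (cases "x \<in> A \<and> 0 < f x")
        case True
        have eq: "AE b in lborel. b \<in> {0..pi} \<longrightarrow> \<Phi> x b = g (x, b)"
          using elim(1)[rule_format, unfolded AE_angle_law] elim(2) True
          by (auto elim: eventually_elim2)
        have "(\<integral>\<^sup>+ b\<in>{0..pi}. \<Phi> x b * ennreal (f x * (1 / pi)) \<partial>lborel)
            = (\<integral>\<^sup>+ b. (g (x, b) * indicator {0..pi} b) * ennreal (f x * (1 / pi)) \<partial>lborel)"
          using eq by (intro nn_integral_cong_AE) (auto elim!: eventually_mono split: split_indicator)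
        also have "\<dots> = (\<integral>\<^sup>+ b. g (x, b) * indicator {0..pi} b \<partial>lborel) * ennreal (f x * (1 / pi))"
          by (rule nn_integral_multc) measurable
        also have "\<dots> = (\<integral>\<^sup>+ b. g (x, b) * indicator {0..pi} b \<partial>lborel) * (ennreal (f x) / ennreal pi)"
          using True by (simp add: divide_ennreal)
        also have "\<dots> = ennreal (f x) * (\<integral>\<^sup>+ b. g (x, b) \<partial>angle_law)"
          by (subst nn_integral_angle_law) (auto simp: divide_ennreal_def mult_ac)
        finally have "(\<integral>\<^sup>+ b\<in>{0..pi}. \<Phi> x b * ennreal (f x * (1 / pi)) \<partial>lborel)
            = ennreal (f x) * (\<integral>\<^sup>+ b. g (x, b) \<partial>angle_law)" .
        then show ?thesis using True by (simp only: indicator_simps mult_1_right)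
      next
        case False
        have "ennreal (f x) = 0 \<and> ennreal (f x * (1 / pi)) = 0" if "x \<in> A"
          using False that by (intro conjI ennreal_neg) (auto simp: not_less divide_nonpos_pos)
        then show ?thesis by (cases "x \<in> A") simp_all
      qed
    qed
  qed
  finally show "(\<integral>\<^sup>+ y. F y \<partial>\<mu>) = (\<integral>\<^sup>+ x\<in>A. (\<integral>\<^sup>+ b\<in>{0..pi}. \<Phi> x b * ennreal (f x * (1 / pi)) \<partial>lborel) \<partial>lborel)"
    using g(3) by simp
qed

section \<open>Clutter and interference\<close>

lemma cos_half_nonneg: "b \<in> {0..pi} \<Longrightarrow> 0 \<le> cos (b / 2)"
  by (intro cos_ge_zero) auto

lemma measurable_p_LOS [measurable]: "p_LOS p \<in> borel_measurable borel"
  unfolding p_LOS_def[abs_def] by measurable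

lemma p_LOS_bounds:
  assumes "valid_params p"
  shows "0 \<le> p_LOS p r" "0 \<le> r \<Longrightarrow> p_LOS p r \<le> 1"
  using assms by (auto simp: p_LOS_def valid_params_def)

lemma clutter_law_laplace:
  assumes v: "valid_params p" and C: "clutter_law p a S" and a: "0 \<le> a"
  shows "prob_space S" "sets S = sets borel"
    "0 \<le> s \<Longrightarrow> (\<integral>\<^sup>+ y. exp_neg (ennreal s * y) \<partial>S)
      = ennreal (exp (- lam_cl p * a * (s * sig_cl p / (1 + s * sig_cl p))))"
proof -
  obtain A where A: "A \<in> sets (borel :: (real^2) measure)" "emeasure lborel A = ennreal a"
    and SN: "shot_noise_law (density lborel (\<lambda>_. ennreal (lam_cl p))) (indicator A) (exp_law (sig_cl p)) S"
    using C unfolding clutter_law_def by blast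
  have pos: "lam_cl p > 0" "sig_cl p > 0" using v by (auto simp: valid_params_def)
  have sets: "sets (density lborel (\<lambda>_. ennreal (lam_cl p))) = sets (borel :: (real^2) measure)" by simp
  have f: "(indicator A :: _ \<Rightarrow> ennreal) \<in> borel_measurable borel" using A by simp
  note L = shot_noise_law_laplace[OF SN sets f prob_space_exp_law[OF pos(2)] sets_exp_law]
  show "prob_space S" "sets S = sets borel" by (rule L)+
  assume s: "0 \<le> s"
  define q where "q = s * sig_cl p / (1 + s * sig_cl p)"
  have s1: "1 + s * sig_cl p > 0" using s pos by (intro add_pos_nonneg) auto
  have q0: "q \<ge> 0" using s s1 pos by (simp add: q_def)
  have q1: "1 - 1 / (1 + s * sig_cl p) = q" using s1 by (simp add: q_def field_simps)
  have "1 - (\<integral>\<^sup>+ h. exp_neg (ennreal s * indicator A x * h) \<partial>exp_law (sig_cl p)) = ennreal q * indicator A x" for x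
  proof (cases "x \<in> A")
    case True
    have "1 - ennreal (1 / (1 + s * sig_cl p)) = ennreal (1 - 1 / (1 + s * sig_cl p))"
      using s1 by (subst ennreal_minus[symmetric]) auto
    then show ?thesis using True s pos by (simp add: laplace_exp_law q1)
  qed (simp add: prob_space.emeasure_space_1[OF prob_space_exp_law[OF pos(2)]])
  then have "(\<integral>\<^sup>+ y. exp_neg (ennreal s * y) \<partial>S)
      = exp_neg (\<integral>\<^sup>+ x. ennreal q * indicator A x \<partial>density lborel (\<lambda>_. ennreal (lam_cl p)))"
    by (simp add: L(3))
  also have "(\<integral>\<^sup>+ x. ennreal q * indicator A x \<partial>density lborel (\<lambda>_. ennreal (lam_cl p))) = ennreal (lam_cl p * (q * a))"
    using A pos q0 a by (subst nn_integral_density) (auto simp: nn_integral_cmult nn_integral_cmult_indicator ennreal_mult)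
  also have "exp_neg \<dots> = ennreal (exp (- (lam_cl p * (q * a))))"
    using pos q0 a by (intro exp_neg_ennreal) simp
  finally show "(\<integral>\<^sup>+ y. exp_neg (ennreal s * y) \<partial>S) = ennreal (exp (- lam_cl p * a * (s * sig_cl p / (1 + s * sig_cl p))))"
    unfolding q_def by (simp add: mult_ac)
qed

text \<open>Common form of the four interference sums: power-law response, radial intensity g, marks
  with Laplace transform l. The response depends on the norm only, which turns the planar integral
  in the Laplace functional into a radial one.\<close>

lemma shot_noise_outer_laplace:
  assumes SN: "shot_noise_law (outer_intensity R g) (\<lambda>x. ennreal (k * norm x powr (- e))) m \<nu>"
    and R: "0 \<le> R" and k: "0 \<le> k"
    and g[measurable]: "g \<in> borel_measurable borel" and g0: "\<And>r. R \<le> r \<Longrightarrow> 0 \<le> g r"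
    and m: "prob_space m" "sets m = sets borel"
    and l[measurable]: "l \<in> borel_measurable borel"
    and l0: "\<And>s. 0 \<le> s \<Longrightarrow> 0 \<le> l s"
    and lap: "\<And>s. 0 \<le> s \<Longrightarrow> (\<integral>\<^sup>+ h. exp_neg (ennreal s * h) \<partial>m) = ennreal (l s)"
  shows "prob_space \<nu>" "sets \<nu> = sets borel"
    "0 \<le> s \<Longrightarrow> (\<integral>\<^sup>+ y. exp_neg (ennreal s * y) \<partial>\<nu>)
      = exp_neg (\<integral>\<^sup>+ r\<in>{R..}. ennreal (g r * (1 - l (s * k * r powr (- e))) * (2 * pi * r)) \<partial>lborel)"
proof -
  have f: "(\<lambda>x :: real^2. ennreal (k * norm x powr (- e))) \<in> borel_measurable borel" by measurable
  note L = shot_noise_law_laplace[OF SN sets_outer_intensity f m]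
  show "prob_space \<nu>" "sets \<nu> = sets borel" by (rule L)+
  assume s: "0 \<le> s"
  \<comment> \<open>The transform of a probability law is at most 1; this makes 1 - l nonnegative,
    so that a product of ennreal factors is the ennreal of the real product.\<close>
  have l1: "l t \<le> 1" if "0 \<le> t" for t
  proof -
    have "ennreal (l t) \<le> (\<integral>\<^sup>+ h. 1 \<partial>m)"
      unfolding lap[OF that, symmetric] by (intro nn_integral_mono) simp
    then show ?thesis by (simp add: prob_space.emeasure_space_1[OF m(1)])
  qed
  have "1 - (\<integral>\<^sup>+ h. exp_neg (ennreal s * ennreal (k * norm x powr (- e)) * h) \<partial>m)
      = ennreal (1 - l (s * k * norm x powr (- e)))" for x :: "real^2"
  proof -
    have "ennreal s * ennreal (k * norm x powr (- e)) = ennreal (s * k * norm x powr (- e))"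
      using s k by (simp add: ennreal_mult[symmetric] mult.assoc)
    moreover have "0 \<le> s * k * norm x powr (- e)" using s k by simp
    ultimately show ?thesis
      using l0 by (simp add: lap ennreal_minus[symmetric])
  qed
  then have "(\<integral>\<^sup>+ y. exp_neg (ennreal s * y) \<partial>\<nu>)
      = exp_neg (\<integral>\<^sup>+ x. ennreal (1 - l (s * k * norm x powr (- e))) \<partial>outer_intensity R g)"
    by (simp add: L(3))
  also have "(\<integral>\<^sup>+ x. ennreal (1 - l (s * k * norm x powr (- e))) \<partial>outer_intensity R g)
      = (\<integral>\<^sup>+ r. ennreal (g r) * ennreal (2 * pi * r) * ennreal (1 - l (s * k * r powr (- e))) * indicator {R..} r \<partial>lborel)"
    by (rule nn_integral_outer_intensity[OF g _ R]) measurable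
  also have "\<dots> = (\<integral>\<^sup>+ r\<in>{R..}. ennreal (g r * (1 - l (s * k * r powr (- e))) * (2 * pi * r)) \<partial>lborel)"
    using R g0 l1 s k
    by (intro nn_integral_cong) (auto simp: mult_ac split: split_indicator simp flip: ennreal_mult)
  finally show "(\<integral>\<^sup>+ y. exp_neg (ennreal s * y) \<partial>\<nu>)
      = exp_neg (\<integral>\<^sup>+ r\<in>{R..}. ennreal (g r * (1 - l (s * k * r powr (- e))) * (2 * pi * r)) \<partial>lborel)" .
qed

lemma set_nn_integral_cmult_ennreal:
  assumes [measurable]: "F \<in> borel_measurable borel" and A[measurable]: "A \<in> sets borel" and c: "0 \<le> c"
    and eq: "\<And>r. r \<in> A \<Longrightarrow> G r = c * F r"
  shows "(\<integral>\<^sup>+ r\<in>A. ennreal (G r) \<partial>lborel) = ennreal c * (\<integral>\<^sup>+ r\<in>A. ennreal (F r) \<partial>lborel)"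
proof -
  have "(\<integral>\<^sup>+ r\<in>A. ennreal (G r) \<partial>lborel) = (\<integral>\<^sup>+ r. ennreal c * (ennreal (F r) * indicator A r) \<partial>lborel)"
    using c eq by (intro nn_integral_cong) (auto split: split_indicator simp: ennreal_mult')
  then show ?thesis by (simp add: nn_integral_cmult)
qed

lemma nn_integral_pair_mult:
  assumes "prob_space M1" "prob_space M2"
    and [measurable]: "f \<in> borel_measurable M1" "g \<in> borel_measurable M2"
  shows "(\<integral>\<^sup>+ y. f (fst y) * g (snd y) \<partial>(M1 \<Otimes>\<^sub>M M2)) = (\<integral>\<^sup>+ x. f x \<partial>M1) * (\<integral>\<^sup>+ x. g x \<partial>M2)"
proof -
  interpret M2: prob_space M2 by fact
  have "(\<integral>\<^sup>+ y. f (fst y) * g (snd y) \<partial>(M1 \<Otimes>\<^sub>M M2)) = (\<integral>\<^sup>+ x. \<integral>\<^sup>+ y. f x * g y \<partial>M2 \<partial>M1)"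
    by (subst M2.nn_integral_fst[symmetric]) auto
  then show ?thesis by (simp add: nn_integral_cmult nn_integral_multc)
qed

lemma laplace_pair_sum:
  assumes "prob_space \<nu>1" "prob_space \<nu>2" and s[measurable_cong]: "sets \<nu>1 = sets borel" "sets \<nu>2 = sets borel"
  shows "(\<integral>\<^sup>+ y. exp_neg (c * (fst y + snd y)) \<partial>(\<nu>1 \<Otimes>\<^sub>M \<nu>2))
    = (\<integral>\<^sup>+ y. exp_neg (c * y) \<partial>\<nu>1) * (\<integral>\<^sup>+ y. exp_neg (c * y) \<partial>\<nu>2)"
  unfolding distrib_left exp_neg_add by (rule nn_integral_pair_mult[OF assms(1,2)]) measurable

text \<open>Given the mixing pair, the two sums are independent and their transforms multiply. The
  marks of the second sum are themselves clutter sums, so the transform from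
  \<open>clutter_law_laplace\<close> takes the place of the mark transform; this is the origin of
  the nested exponential in \<open>L_IC\<close>.\<close>

lemma IC_law_laplace:
  assumes v: "valid_params p" and IC: "IC_law p r1 a LI" and r1: "0 \<le> r1" and a: "0 \<le> a" and s: "0 \<le> s"
  shows "prob_space LI" "sets LI = sets (borel \<Otimes>\<^sub>M borel)"
    "(\<integral>\<^sup>+ y. exp_neg (ennreal s * (fst y + snd y)) \<partial>LI) = L_IC p r1 s a"
proof -
  have pos: "lam_BS p > 0" "sig_t p > 0" "sig_cl p > 0" "lam_cl p > 0" "eta_L p > 0" "real (beams p) > 0"
    using v by (auto simp: valid_params_def)
  have s1: "1 + t * sig_t p > 0" "1 + t * sig_cl p > 0" if "0 \<le> t" for t
    using that pos by (auto intro: add_pos_nonneg)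
  define \<Phi> where "\<Phi> ric b =
      exp_neg (ennreal (2 * pi * lam_BS p / beams p) *
        (\<integral>\<^sup>+ r\<in>{ric..}. ennreal (p_LOS p r *
           (1 - 1 / (1 + s * cos (b / 2) * r powr (- eta_L p) * sig_t p)) * r) \<partial>lborel)) *
      exp_neg (ennreal (lam_BS p / beams p) *
        (\<integral>\<^sup>+ r\<in>{ric..}. ennreal (p_LOS p r *
           (1 - exp (- lam_cl p * a * (s * cos (b / 2) * r powr (- eta_L p) * sig_cl p
                      / (1 + s * cos (b / 2) * r powr (- eta_L p) * sig_cl p)))) * (2 * pi * r)) \<partial>lborel))" for ric b
  let ?C = "\<lambda>(ric, b) \<nu>.
      let \<Lambda> = outer_intensity ric (\<lambda>r. p_LOS p r * lam_BS p / beams p);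
          f = (\<lambda>x. ennreal (cos (b / 2) * norm x powr (- eta_L p)))
      in \<exists>S \<nu>1 \<nu>2. clutter_law p a S \<and> shot_noise_law \<Lambda> f (exp_law (sig_t p)) \<nu>1 \<and>
           shot_noise_law \<Lambda> f S \<nu>2 \<and> \<nu> = \<nu>1 \<Otimes>\<^sub>M \<nu>2"
  \<comment> \<open>The value depends on \<open>ric\<close> and \<open>b\<close> alone, whichever
    witnesses \<open>S\<close>, \<open>\<nu>1\<close>, \<open>\<nu>2\<close> realise the
    relation.\<close>
  have key: "(\<integral>\<^sup>+ y. exp_neg (ennreal s * (fst y + snd y)) \<partial>\<nu>) = \<Phi> ric b"
    if ric: "r1 \<le> ric" and b: "b \<in> {0..pi}" and C: "?C (ric, b) \<nu>" for ric b \<nu>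
  proof -
    let ?g = "\<lambda>r. p_LOS p r * lam_BS p / beams p"
    obtain S \<nu>1 \<nu>2 where S: "clutter_law p a S"
      and 1: "shot_noise_law (outer_intensity ric ?g) (\<lambda>x. ennreal (cos (b / 2) * norm x powr (- eta_L p))) (exp_law (sig_t p)) \<nu>1"
      and 2: "shot_noise_law (outer_intensity ric ?g) (\<lambda>x. ennreal (cos (b / 2) * norm x powr (- eta_L p))) S \<nu>2"
      and \<nu>: "\<nu> = \<nu>1 \<Otimes>\<^sub>M \<nu>2"
      using C by (auto simp: Let_def)
    note cl = clutter_law_laplace[OF v S a]
    have ric0: "0 \<le> ric" using ric r1 by simp
    have g: "?g \<in> borel_measurable borel" by measurable
    have g0: "0 \<le> ?g r" for r using p_LOS_bounds[OF v] pos by simp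
    note L1 = shot_noise_outer_laplace[where l="\<lambda>t. 1 / (1 + t * sig_t p)",
        OF 1 ric0 cos_half_nonneg[OF b] g g0 prob_space_exp_law[OF pos(2)] sets_exp_law _ _ laplace_exp_law[OF pos(2)]]
    note L2 = shot_noise_outer_laplace[where l="\<lambda>t. exp (- lam_cl p * a * (t * sig_cl p / (1 + t * sig_cl p)))",
        OF 2 ric0 cos_half_nonneg[OF b] g g0 cl(1,2) _ _ cl(3)]
    have "(\<integral>\<^sup>+ y. exp_neg (ennreal s * (fst y + snd y)) \<partial>\<nu>)
        = (\<integral>\<^sup>+ y. exp_neg (ennreal s * y) \<partial>\<nu>1) * (\<integral>\<^sup>+ y. exp_neg (ennreal s * y) \<partial>\<nu>2)"
      unfolding \<nu> using s1 by (intro laplace_pair_sum L1(1,2) L2(1,2)) (auto intro: less_imp_le)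
    also have "(\<integral>\<^sup>+ y. exp_neg (ennreal s * y) \<partial>\<nu>1) =
        exp_neg (\<integral>\<^sup>+ r\<in>{ric..}. ennreal (?g r * (1 - 1 / (1 + s * cos (b / 2) * r powr (- eta_L p) * sig_t p)) * (2 * pi * r)) \<partial>lborel)"
      using s s1 by (intro L1(3)) (auto intro: less_imp_le)
    also have "(\<integral>\<^sup>+ r\<in>{ric..}. ennreal (?g r * (1 - 1 / (1 + s * cos (b / 2) * r powr (- eta_L p) * sig_t p)) * (2 * pi * r)) \<partial>lborel)
        = ennreal (2 * pi * lam_BS p / beams p) * (\<integral>\<^sup>+ r\<in>{ric..}. ennreal (p_LOS p r *
           (1 - 1 / (1 + s * cos (b / 2) * r powr (- eta_L p) * sig_t p)) * r) \<partial>lborel)"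
      using pos by (intro set_nn_integral_cmult_ennreal) auto
    also have "(\<integral>\<^sup>+ y. exp_neg (ennreal s * y) \<partial>\<nu>2) =
        exp_neg (\<integral>\<^sup>+ r\<in>{ric..}. ennreal (?g r * (1 - exp (- lam_cl p * a * (s * cos (b / 2) * r powr (- eta_L p) * sig_cl p
                      / (1 + s * cos (b / 2) * r powr (- eta_L p) * sig_cl p)))) * (2 * pi * r)) \<partial>lborel)"
      using s by (intro L2(3)) auto
    also have "(\<integral>\<^sup>+ r\<in>{ric..}. ennreal (?g r * (1 - exp (- lam_cl p * a * (s * cos (b / 2) * r powr (- eta_L p) * sig_cl p
                      / (1 + s * cos (b / 2) * r powr (- eta_L p) * sig_cl p)))) * (2 * pi * r)) \<partial>lborel)
        = ennreal (lam_BS p / beams p) *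
          (\<integral>\<^sup>+ r\<in>{ric..}. ennreal (p_LOS p r *
           (1 - exp (- lam_cl p * a * (s * cos (b / 2) * r powr (- eta_L p) * sig_cl p
                      / (1 + s * cos (b / 2) * r powr (- eta_L p) * sig_cl p)))) * (2 * pi * r)) \<partial>lborel)"
      using pos by (intro set_nn_integral_cmult_ennreal) auto
    finally show ?thesis unfolding \<Phi>_def .
  qed
  have mix: "mixture_law (real_law_on {r1..} (interferer_pdf p r1) \<Otimes>\<^sub>M angle_law) (borel \<Otimes>\<^sub>M borel) ?C LI"
    using IC unfolding IC_law_def .
  have f: "interferer_pdf p r1 \<in> borel_measurable borel"
    unfolding interferer_pdf_eq by measurable
  have one: "(\<integral>\<^sup>+ x. ennreal (interferer_pdf p r1 x) * indicator {r1..} x \<partial>lborel) = 1"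
    unfolding interferer_pdf_eq by (rule nn_integral_nth_nearest_pdf[OF pos(1) r1]) simp
  have F: "(\<lambda>y. exp_neg (ennreal s * (fst y + snd y))) \<in> borel_measurable (borel \<Otimes>\<^sub>M borel)" by measurable
  have C: "AE x in lborel. AE b in lborel. \<forall>\<nu>. x \<in> {r1..} \<longrightarrow> b \<in> {0..pi} \<longrightarrow> ?C (x, b) \<nu> \<longrightarrow>
      (\<integral>\<^sup>+ y. exp_neg (ennreal s * (fst y + snd y)) \<partial>\<nu>) = \<Phi> x b"
    using key by (intro AE_I2 allI impI) (simp only: atLeast_iff)
  note R = mixture_law_real_angle[OF mix f _ one F C]
  show "prob_space LI" "sets LI = sets (borel \<Otimes>\<^sub>M borel)" by (rule R; simp)+
  \<comment> \<open>The angle density 1 / pi cancels the pi of \<open>interferer_pdf\<close>, which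
    leaves the prefactor 2 lam_BS seen in \<open>L_IC\<close>.\<close>
  have pdf: "interferer_pdf p r1 x * (1 / pi) = 2 * lam_BS p * x * exp (- lam_BS p * pi * (x\<^sup>2 - r1\<^sup>2))" for x
    by (simp add: interferer_pdf_def)
  show "(\<integral>\<^sup>+ y. exp_neg (ennreal s * (fst y + snd y)) \<partial>LI) = L_IC p r1 s a"
    unfolding L_IC_def using R(3) unfolding \<Phi>_def pdf by simp
qed

text \<open>Same mechanism with Gamma marks and a single mixing radius: given this radius, the
  line-of-sight and the remaining interferers are independent, so their transforms multiply.\<close>

lemma D_law_laplace:
  assumes v: "valid_params p" and D: "D_law p LD" and s: "0 \<le> s"
  shows "prob_space LD" "sets LD = sets (borel \<Otimes>\<^sub>M borel)"
    "(\<integral>\<^sup>+ y. exp_neg (ennreal s * (fst y + snd y)) \<partial>LD) = L_D p s"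
proof -
  have pos: "lam_BS p > 0" "m_L p > 0" "m_N p > 0" "P_c p > 0" "G_m p > 0" "C_L p > 0" "C_N p > 0" "real (beams p) > 0"
    using v by (auto simp: valid_params_def)
  define \<Phi> where "\<Phi> rd =
      exp_neg (ennreal (2 * pi * lam_BS p / (beams p)\<^sup>2) *
        (\<integral>\<^sup>+ r\<in>{rd..}. ennreal (p_LOS p r *
           (1 - (1 + s * P_c p * (G_m p)\<^sup>2 * C_L p * r powr (- eta_L p) / m_L p) powr (- m_L p)) * r) \<partial>lborel)) *
      exp_neg (ennreal (2 * pi * lam_BS p / (beams p)\<^sup>2) *
        (\<integral>\<^sup>+ r\<in>{rd..}. ennreal ((1 - p_LOS p r) *
           (1 - (1 + s * P_c p * (G_m p)\<^sup>2 * C_N p * r powr (- eta_N p) / m_N p) powr (- m_N p)) * r) \<partial>lborel))" for rd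
  let ?C = "\<lambda>rd \<nu>. \<exists>\<nu>L \<nu>N.
      shot_noise_law (outer_intensity rd (\<lambda>r. p_LOS p r * lam_BS p / (beams p)\<^sup>2))
        (\<lambda>x. ennreal (P_c p * (G_m p)\<^sup>2 * C_L p * norm x powr (- eta_L p))) (gamma_law (m_L p)) \<nu>L \<and>
      shot_noise_law (outer_intensity rd (\<lambda>r. (1 - p_LOS p r) * lam_BS p / (beams p)\<^sup>2))
        (\<lambda>x. ennreal (P_c p * (G_m p)\<^sup>2 * C_N p * norm x powr (- eta_N p))) (gamma_law (m_N p)) \<nu>N \<and>
      \<nu> = \<nu>L \<Otimes>\<^sub>M \<nu>N"
  have key: "(\<integral>\<^sup>+ y. exp_neg (ennreal s * (fst y + snd y)) \<partial>\<nu>) = \<Phi> rd"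
    if rd: "0 \<le> rd" and C: "?C rd \<nu>" for rd \<nu>
  proof -
    obtain \<nu>L \<nu>N where
      L: "shot_noise_law (outer_intensity rd (\<lambda>r. p_LOS p r * lam_BS p / (beams p)\<^sup>2))
        (\<lambda>x. ennreal (P_c p * (G_m p)\<^sup>2 * C_L p * norm x powr (- eta_L p))) (gamma_law (m_L p)) \<nu>L"
      and N: "shot_noise_law (outer_intensity rd (\<lambda>r. (1 - p_LOS p r) * lam_BS p / (beams p)\<^sup>2))
        (\<lambda>x. ennreal (P_c p * (G_m p)\<^sup>2 * C_N p * norm x powr (- eta_N p))) (gamma_law (m_N p)) \<nu>N"
      and \<nu>: "\<nu> = \<nu>L \<Otimes>\<^sub>M \<nu>N"
      using C by blast
    have k: "0 \<le> P_c p * (G_m p)\<^sup>2 * C_L p" "0 \<le> P_c p * (G_m p)\<^sup>2 * C_N p" using pos by auto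
    have g: "(\<lambda>r. p_LOS p r * lam_BS p / (beams p)\<^sup>2) \<in> borel_measurable borel"
      "(\<lambda>r. (1 - p_LOS p r) * lam_BS p / (beams p)\<^sup>2) \<in> borel_measurable borel" by measurable
    \<comment> \<open>The restriction to r \<ge> rd \<ge> 0 matters for the second intensity: 1 -
      \<open>p_LOS p r\<close> is negative for r < 0.\<close>
    have g0: "0 \<le> p_LOS p r * lam_BS p / (beams p)\<^sup>2" "0 \<le> (1 - p_LOS p r) * lam_BS p / (beams p)\<^sup>2" if "rd \<le> r" for r
      using p_LOS_bounds[OF v, of r] pos that rd by auto
    note LL = shot_noise_outer_laplace[where l="\<lambda>t. (1 + t / m_L p) powr (- m_L p)",
        OF L rd k(1) g(1) g0(1) prob_space_gamma_law[OF pos(2)] sets_gamma_law _ _ laplace_gamma_law[OF pos(2)]]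
    note NN = shot_noise_outer_laplace[where l="\<lambda>t. (1 + t / m_N p) powr (- m_N p)",
        OF N rd k(2) g(2) g0(2) prob_space_gamma_law[OF pos(3)] sets_gamma_law _ _ laplace_gamma_law[OF pos(3)]]
    have "(\<integral>\<^sup>+ y. exp_neg (ennreal s * (fst y + snd y)) \<partial>\<nu>)
        = (\<integral>\<^sup>+ y. exp_neg (ennreal s * y) \<partial>\<nu>L) * (\<integral>\<^sup>+ y. exp_neg (ennreal s * y) \<partial>\<nu>N)"
      unfolding \<nu> by (intro laplace_pair_sum LL(1,2) NN(1,2)) auto
    also have "(\<integral>\<^sup>+ y. exp_neg (ennreal s * y) \<partial>\<nu>L) = exp_neg (\<integral>\<^sup>+ r\<in>{rd..}. ennreal (p_LOS p r * lam_BS p / (beams p)\<^sup>2 *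
        (1 - (1 + s * (P_c p * (G_m p)\<^sup>2 * C_L p) * r powr (- eta_L p) / m_L p) powr (- m_L p)) * (2 * pi * r)) \<partial>lborel)"
      using s by (intro LL(3)) auto
    also have "(\<integral>\<^sup>+ r\<in>{rd..}. ennreal (p_LOS p r * lam_BS p / (beams p)\<^sup>2 *
        (1 - (1 + s * (P_c p * (G_m p)\<^sup>2 * C_L p) * r powr (- eta_L p) / m_L p) powr (- m_L p)) * (2 * pi * r)) \<partial>lborel)
        = ennreal (2 * pi * lam_BS p / (beams p)\<^sup>2) * (\<integral>\<^sup>+ r\<in>{rd..}. ennreal (p_LOS p r *
           (1 - (1 + s * P_c p * (G_m p)\<^sup>2 * C_L p * r powr (- eta_L p) / m_L p) powr (- m_L p)) * r) \<partial>lborel)"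
      using pos by (intro set_nn_integral_cmult_ennreal) (auto simp: mult_ac)
    also have "(\<integral>\<^sup>+ y. exp_neg (ennreal s * y) \<partial>\<nu>N) = exp_neg (\<integral>\<^sup>+ r\<in>{rd..}. ennreal ((1 - p_LOS p r) * lam_BS p / (beams p)\<^sup>2 *
        (1 - (1 + s * (P_c p * (G_m p)\<^sup>2 * C_N p) * r powr (- eta_N p) / m_N p) powr (- m_N p)) * (2 * pi * r)) \<partial>lborel)"
      using s by (intro NN(3)) auto
    also have "(\<integral>\<^sup>+ r\<in>{rd..}. ennreal ((1 - p_LOS p r) * lam_BS p / (beams p)\<^sup>2 *
        (1 - (1 + s * (P_c p * (G_m p)\<^sup>2 * C_N p) * r powr (- eta_N p) / m_N p) powr (- m_N p)) * (2 * pi * r)) \<partial>lborel)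
        = ennreal (2 * pi * lam_BS p / (beams p)\<^sup>2) * (\<integral>\<^sup>+ r\<in>{rd..}. ennreal ((1 - p_LOS p r) *
           (1 - (1 + s * P_c p * (G_m p)\<^sup>2 * C_N p * r powr (- eta_N p) / m_N p) powr (- m_N p)) * r) \<partial>lborel)"
      using pos by (intro set_nn_integral_cmult_ennreal) (auto simp: mult_ac)
    finally show ?thesis unfolding \<Phi>_def .
  qed
  have mix: "mixture_law (real_law_on {0..} (nearest_pdf p)) (borel \<Otimes>\<^sub>M borel) ?C LD"
    using D unfolding D_law_def .
  have f: "nearest_pdf p \<in> borel_measurable borel"
    unfolding nearest_pdf_eq by measurable
  have one: "(\<integral>\<^sup>+ x. ennreal (nearest_pdf p x) * indicator {0..} x \<partial>lborel) = 1"
    unfolding nearest_pdf_eq by (rule nn_integral_nth_nearest_pdf[OF pos(1)]) simp_all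
  have F: "(\<lambda>y. exp_neg (ennreal s * (fst y + snd y))) \<in> borel_measurable (borel \<Otimes>\<^sub>M borel)" by measurable
  have C: "AE x in lborel. \<forall>\<nu>. x \<in> {0..} \<longrightarrow> ?C x \<nu> \<longrightarrow>
      (\<integral>\<^sup>+ y. exp_neg (ennreal s * (fst y + snd y)) \<partial>\<nu>) = \<Phi> x"
    using key by (intro AE_I2 allI impI) (simp only: atLeast_iff)
  show "prob_space LD" "sets LD = sets (borel \<Otimes>\<^sub>M borel)"
    by (rule mixture_law_prob_space[OF mix prob_space_real_law_on[OF f _ one]]; simp)+
  show "(\<integral>\<^sup>+ y. exp_neg (ennreal s * (fst y + snd y)) \<partial>LD) = L_D p s"
    unfolding L_D_def using mixture_law_real[OF mix f _ one F C] unfolding \<Phi>_def nearest_pdf_def by simp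
qed

section \<open>Complementary distribution functions of the SINRs\<close>

text \<open>Both kinds of SINR have this shape: c multiplies target and clutter alike, c2 the
  interference pair, n is the thermal noise, and z is the constant \<open>P_c p * zeta p\<close> of
  the monostatic case and 0 in the bistatic one. Integrating out the exponential cross-section
  leaves \<open>exp_neg\<close> of h times the denominator, with h = \<phi> / (c \<sigma>), and this
  factorises over the independent blocks. As the clutter carries the same coefficient c, its
  argument h c = \<phi> / \<sigma> is free of distances.\<close>

lemma emeasure_SINR_greater:
  fixes c c2 n z \<phi> \<sigma> :: real
  defines "Den \<equiv> \<lambda>y :: ennreal \<times> (ennreal \<times> ennreal) \<times> (ennreal \<times> ennreal).
    ennreal c * fst y + ennreal c2 * (fst (fst (snd y)) + snd (fst (snd y)))
      + ennreal n + fst (snd (snd y)) + snd (snd (snd y)) + ennreal z"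
  assumes pos: "0 < \<sigma>" "0 < \<phi>" "0 < c" "0 \<le> c2" "0 < n" "0 \<le> z"
    and LS: "prob_space LS" and [measurable_cong]: "sets LS = sets borel"
    and LI: "prob_space LI" and [measurable_cong]: "sets LI = sets (borel \<Otimes>\<^sub>M borel)"
    and LD: "prob_space LD" and [measurable_cong]: "sets LD = sets (borel \<Otimes>\<^sub>M borel)"
  shows "prob_space (exp_law \<sigma> \<Otimes>\<^sub>M LS \<Otimes>\<^sub>M LI \<Otimes>\<^sub>M LD)"
    "(\<lambda>w. ennreal c * fst w / Den (snd w)) \<in> borel_measurable (exp_law \<sigma> \<Otimes>\<^sub>M LS \<Otimes>\<^sub>M LI \<Otimes>\<^sub>M LD)"
    "emeasure (exp_law \<sigma> \<Otimes>\<^sub>M LS \<Otimes>\<^sub>M LI \<Otimes>\<^sub>M LD)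
        {w \<in> space (exp_law \<sigma> \<Otimes>\<^sub>M LS \<Otimes>\<^sub>M LI \<Otimes>\<^sub>M LD). ennreal \<phi> < ennreal c * fst w / Den (snd w)}
      = (\<integral>\<^sup>+ y. exp_neg (ennreal (\<phi> / \<sigma>) * y) \<partial>LS) *
        (\<integral>\<^sup>+ y. exp_neg (ennreal (\<phi> * c2 / (c * \<sigma>)) * (fst y + snd y)) \<partial>LI) *
        ennreal (exp (- (\<phi> / (c * \<sigma>) * (n + z)))) *
        (\<integral>\<^sup>+ y. exp_neg (ennreal (\<phi> / (c * \<sigma>)) * (fst y + snd y)) \<partial>LD)"
proof -
  define W where "W = LS \<Otimes>\<^sub>M LI \<Otimes>\<^sub>M LD"
  define h where "h = \<phi> / (c * \<sigma>)"
  have E: "prob_space (exp_law \<sigma>)" by (rule prob_space_exp_law[OF pos(1)])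
  have ID: "prob_space (LI \<Otimes>\<^sub>M LD)" by (rule prob_space_pair[OF LI LD])
  have W: "prob_space W" unfolding W_def by (rule prob_space_pair[OF LS ID])
  interpret E: prob_space "exp_law \<sigma>" by (rule E)
  interpret W: prob_space W by (rule W)
  interpret EW: pair_prob_space "exp_law \<sigma>" W by unfold_locales
  have [measurable_cong]: "sets W = sets (borel \<Otimes>\<^sub>M (borel \<Otimes>\<^sub>M borel) \<Otimes>\<^sub>M (borel \<Otimes>\<^sub>M borel))"
    unfolding W_def by (intro sets_pair_measure_cong) fact+
  have Den[measurable]: "Den \<in> borel_measurable W"
    unfolding Den_def by measurable
  have "prob_space (exp_law \<sigma> \<Otimes>\<^sub>M W)" by (rule prob_space_pair[OF E W])
  then show "prob_space (exp_law \<sigma> \<Otimes>\<^sub>M LS \<Otimes>\<^sub>M LI \<Otimes>\<^sub>M LD)" unfolding W_def .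
  have T[measurable]: "(\<lambda>w. ennreal c * fst w / Den (snd w)) \<in> borel_measurable (exp_law \<sigma> \<Otimes>\<^sub>M W)"
    unfolding divide_ennreal_def by measurable
  then show "(\<lambda>w. ennreal c * fst w / Den (snd w)) \<in> borel_measurable (exp_law \<sigma> \<Otimes>\<^sub>M LS \<Otimes>\<^sub>M LI \<Otimes>\<^sub>M LD)"
    unfolding W_def .
  have Den0: "0 < Den y" for y
    using pos by (auto simp: Den_def zero_less_iff_neq_zero)
  have h: "0 \<le> h" using pos by (simp add: h_def)
  have split: "exp_neg (ennreal h * Den y) = exp_neg (ennreal (\<phi> / \<sigma>) * fst y) *
      (exp_neg (ennreal (\<phi> * c2 / (c * \<sigma>)) * (fst (fst (snd y)) + snd (fst (snd y)))) *
       (ennreal (exp (- (h * (n + z)))) * exp_neg (ennreal h * (fst (snd (snd y)) + snd (snd (snd y))))))" for y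
  proof -
    have c1: "ennreal h * (ennreal c * x) = ennreal (\<phi> / \<sigma>) * x" for x
      using pos h by (simp add: h_def mult.assoc[symmetric] ennreal_mult[symmetric])
    have c2: "ennreal h * (ennreal c2 * x) = ennreal (\<phi> * c2 / (c * \<sigma>)) * x" for x
      using pos h by (simp add: h_def mult.assoc[symmetric] ennreal_mult[symmetric])
    have nz: "ennreal (exp (- (h * (n + z)))) = exp_neg (ennreal h * (ennreal n + ennreal z))"
      using pos h by (simp add: exp_neg_ennreal[symmetric] ennreal_mult[symmetric] flip: ennreal_plus)
    have "ennreal h * Den y = ennreal h * (ennreal c * fst y)
        + (ennreal h * (ennreal c2 * (fst (fst (snd y)) + snd (fst (snd y))))
        + (ennreal h * (ennreal n + ennreal z) + ennreal h * (fst (snd (snd y)) + snd (snd (snd y)))))"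
      by (simp add: Den_def distrib_left add_ac)
    then show ?thesis
      unfolding nz by (simp only: c1 c2 exp_neg_add)
  qed
  have "emeasure (exp_law \<sigma> \<Otimes>\<^sub>M W) {w \<in> space (exp_law \<sigma> \<Otimes>\<^sub>M W). ennreal \<phi> < ennreal c * fst w / Den (snd w)}
      = (\<integral>\<^sup>+ y. emeasure (exp_law \<sigma>) ((\<lambda>x. (x, y)) -` {w \<in> space (exp_law \<sigma> \<Otimes>\<^sub>M W). ennreal \<phi> < ennreal c * fst w / Den (snd w)}) \<partial>W)"
    by (rule EW.emeasure_pair_measure_alt2) measurable
  also have "\<dots> = (\<integral>\<^sup>+ y. exp_neg (ennreal h * Den y) \<partial>W)"
  proof (rule nn_integral_cong)
    fix y assume y: "y \<in> space W"
    have "(\<lambda>x. (x, y)) -` {w \<in> space (exp_law \<sigma> \<Otimes>\<^sub>M W). ennreal \<phi> < ennreal c * fst w / Den (snd w)}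
        = {x. ennreal \<phi> < ennreal c * x / Den y}"
      using y by (auto simp: space_pair_measure exp_law_def)
    then show "emeasure (exp_law \<sigma>) ((\<lambda>x. (x, y)) -` {w \<in> space (exp_law \<sigma> \<Otimes>\<^sub>M W). ennreal \<phi> < ennreal c * fst w / Den (snd w)})
        = exp_neg (ennreal h * Den y)"
      using pos by (simp only: h_def emeasure_exp_law_ratio[OF pos(1,2,3) Den0])
  qed
  also have "\<dots> = (\<integral>\<^sup>+ y. exp_neg (ennreal (\<phi> / \<sigma>) * y) \<partial>LS) *
      (\<integral>\<^sup>+ y. exp_neg (ennreal (\<phi> * c2 / (c * \<sigma>)) * (fst (fst y) + snd (fst y))) *
       (ennreal (exp (- (h * (n + z)))) * exp_neg (ennreal h * (fst (snd y) + snd (snd y)))) \<partial>(LI \<Otimes>\<^sub>M LD))"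
    unfolding split W_def
    by (rule nn_integral_pair_mult[OF LS ID, where f="\<lambda>y. exp_neg (ennreal (\<phi> / \<sigma>) * y)"]) measurable
  also have "(\<integral>\<^sup>+ y. exp_neg (ennreal (\<phi> * c2 / (c * \<sigma>)) * (fst (fst y) + snd (fst y))) *
       (ennreal (exp (- (h * (n + z)))) * exp_neg (ennreal h * (fst (snd y) + snd (snd y)))) \<partial>(LI \<Otimes>\<^sub>M LD))
     = (\<integral>\<^sup>+ y. exp_neg (ennreal (\<phi> * c2 / (c * \<sigma>)) * (fst y + snd y)) \<partial>LI) *
       (\<integral>\<^sup>+ y. ennreal (exp (- (h * (n + z)))) * exp_neg (ennreal h * (fst y + snd y)) \<partial>LD)"
    by (rule nn_integral_pair_mult[OF LI LD, where f="\<lambda>y. exp_neg (ennreal (\<phi> * c2 / (c * \<sigma>)) * (fst y + snd y))"]) measurable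
  also have "(\<integral>\<^sup>+ y. ennreal (exp (- (h * (n + z)))) * exp_neg (ennreal h * (fst y + snd y)) \<partial>LD)
      = ennreal (exp (- (h * (n + z)))) * (\<integral>\<^sup>+ y. exp_neg (ennreal h * (fst y + snd y)) \<partial>LD)"
    by (rule nn_integral_cmult) measurable
  finally show "emeasure (exp_law \<sigma> \<Otimes>\<^sub>M LS \<Otimes>\<^sub>M LI \<Otimes>\<^sub>M LD)
        {w \<in> space (exp_law \<sigma> \<Otimes>\<^sub>M LS \<Otimes>\<^sub>M LI \<Otimes>\<^sub>M LD). ennreal \<phi> < ennreal c * fst w / Den (snd w)}
      = (\<integral>\<^sup>+ y. exp_neg (ennreal (\<phi> / \<sigma>) * y) \<partial>LS) *
        (\<integral>\<^sup>+ y. exp_neg (ennreal (\<phi> * c2 / (c * \<sigma>)) * (fst y + snd y)) \<partial>LI) *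
        ennreal (exp (- (\<phi> / (c * \<sigma>) * (n + z)))) *
        (\<integral>\<^sup>+ y. exp_neg (ennreal (\<phi> / (c * \<sigma>)) * (fst y + snd y)) \<partial>LD)"
    unfolding W_def h_def by (simp only: mult.assoc)
qed

text \<open>For the monostatic coefficients c2 / c = r1 powr eta_L, while 1 / c contributes r1 powr
  (2 eta_L); these are the powers in the arguments of \<open>L_IC\<close> and \<open>L_D\<close>.
  Positivity of r1 keeps the powers invertible.\<close>

lemma emeasure_SINR_M_greater:
  assumes v: "valid_params p" and r1: "0 < r1" and M: "SINR_M_law p r1 \<nu>"
  shows "prob_space \<nu>" "sets \<nu> = sets borel"
    "0 < t \<Longrightarrow> emeasure \<nu> {x. ennreal (exp t - 1) < x} = P_M p r1 t"
proof -
  obtain LS LI LD where S: "clutter_law p (area_mono p r1) LS" and I: "IC_law p r1 (area_mono p r1) LI" and D: "D_law p LD"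
    and \<nu>: "\<nu> = distr (exp_law (sig_t p) \<Otimes>\<^sub>M LS \<Otimes>\<^sub>M LI \<Otimes>\<^sub>M LD) borel
          (\<lambda>(\<sigma>, S, (I1, I2), (IL, IN)).
             ennreal (kappa p * r1 powr (- 2 * eta_L p)) * \<sigma>
             / (ennreal (kappa p * r1 powr (- 2 * eta_L p)) * S
                + ennreal (kappa p * r1 powr (- eta_L p)) * (I1 + I2)
                + ennreal (noise p) + IL + IN + ennreal (P_c p * zeta p)))"
    using M unfolding SINR_M_law_def by blast
  have pos: "sig_t p > 0" "sig_cl p > 0" "kappa p > 0" "noise p > 0" "P_c p * zeta p \<ge> 0" "area_mono p r1 \<ge> 0"
    using v r1 by (auto simp: valid_params_def kappa_def noise_def area_mono_def)
  have par: "P_s p > 0" "G_m p > 0" "wavelength p > 0"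
    using v by (auto simp: valid_params_def)
  define c where "c = kappa p * r1 powr (- 2 * eta_L p)"
  define c2 where "c2 = kappa p * r1 powr (- eta_L p)"
  have c: "c > 0" "c2 \<ge> 0" using pos r1 by (auto simp: c_def c2_def)
  note LS = clutter_law_laplace[OF v S pos(6)]
  note LI = IC_law_laplace[OF v I less_imp_le[OF r1] pos(6)]
  note LD = D_law_laplace[OF v D]
  define W where "W = exp_law (sig_t p) \<Otimes>\<^sub>M LS \<Otimes>\<^sub>M LI \<Otimes>\<^sub>M LD"
  define T where "T = (\<lambda>w :: ennreal \<times> ennreal \<times> (ennreal \<times> ennreal) \<times> (ennreal \<times> ennreal).
    ennreal c * fst w / (ennreal c * fst (snd w) + ennreal c2 * (fst (fst (snd (snd w))) + snd (fst (snd (snd w))))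
      + ennreal (noise p) + fst (snd (snd (snd w))) + snd (snd (snd (snd w))) + ennreal (P_c p * zeta p)))"
  have \<nu>': "\<nu> = distr W borel T"
    unfolding \<nu> W_def T_def c_def c2_def by (simp add: case_prod_beta')
  \<comment> \<open>\<open>order_refl\<close> sets the transform argument s to 0 where only facts
    free of s are used. The value of \<phi> stays open: the first two facts are needed before t is
    given and are read off at \<phi> = 1.\<close>
  note R = emeasure_SINR_greater[OF pos(1) _ c pos(4,5) LS(1,2) LI(1,2)[OF order_refl] LD(1,2)[OF order_refl], folded W_def]
  have W: "prob_space W" and T[measurable]: "T \<in> borel_measurable W"
    using R(1,2)[of 1] unfolding T_def by auto
  show "prob_space \<nu>" unfolding \<nu>' by (rule prob_space.prob_space_distr[OF W T])
  show "sets \<nu> = sets borel" by (simp add: \<nu>')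
  assume t: "0 < t"
  define \<phi> where "\<phi> = exp t - 1"
  have \<phi>: "0 < \<phi>" using t by (simp add: \<phi>_def)
  let ?A = "(P_s p * (G_m p)\<^sup>2 * (wavelength p)\<^sup>2 * sig_t p)"
  have e0: "\<phi> / sig_t p * sig_cl p / (1 + \<phi> / sig_t p * sig_cl p) = \<phi> * sig_cl p / (sig_t p + \<phi> * sig_cl p)"
  proof -
    have "sig_t p + \<phi> * sig_cl p > 0" using pos \<phi> by (simp add: add_pos_pos)
    moreover have "1 + \<phi> / sig_t p * sig_cl p = (sig_t p + \<phi> * sig_cl p) / sig_t p"
      using pos by (simp add: field_simps)
    ultimately show ?thesis using pos by (simp add: field_simps)
  qed
  have rr: "r1 powr (- 2 * eta_L p) = inverse (r1 powr (2 * eta_L p))" "r1 powr (2 * eta_L p) = r1 powr eta_L p * r1 powr eta_L p"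
    "r1 powr (- eta_L p) = inverse (r1 powr eta_L p)" "r1 powr eta_L p > 0"
    using r1 by (auto simp: powr_minus[symmetric] powr_add[symmetric])
  have e1: "\<phi> * c2 / (c * sig_t p) = \<phi> * r1 powr eta_L p / sig_t p"
    using rr(4) pos unfolding c_def c2_def rr(1,2,3) by (simp add: field_simps)
  have e2: "\<phi> / (c * sig_t p) = \<phi> * (4 * pi) ^ 3 * r1 powr (2 * eta_L p) / ?A"
    using rr(4) pos par unfolding c_def rr(1,2) kappa_def by (simp add: field_simps)
  have "emeasure \<nu> {x. ennreal \<phi> < x} = emeasure W {w \<in> space W. ennreal \<phi> < T w}"
    unfolding \<nu>' by (subst emeasure_distr) (auto intro!: arg_cong[where f="emeasure W"])
  also have "\<dots> = P_M p r1 t"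
  proof -
    have s: "0 \<le> \<phi> / sig_t p" "0 \<le> \<phi> * r1 powr eta_L p / sig_t p" "0 \<le> \<phi> * (4 * pi) ^ 3 * r1 powr (2 * eta_L p) / ?A"
      using \<phi> pos par by auto
    show ?thesis
      unfolding T_def R(3)[OF \<phi>] e1 e2 LS(3)[OF s(1)] LI(3)[OF s(2)] LD(3)[OF s(3)] e0 P_M_def Let_def
      unfolding \<phi>_def[symmetric] area_mono_def noise_def
      by simp
  qed
  finally show "emeasure \<nu> {x. ennreal (exp t - 1) < x} = P_M p r1 t" unfolding \<phi>_def .
qed

text \<open>Since \<phi> > 0, the SINR can exceed \<phi> only if the Bernoulli variable succeeds,
  which contributes the first factor; on success the general formula applies. The bound b < pi makes
  cos (b / 2), hence c, positive. In c2 / c = r1 powr eta_L / cos (b / 2) the distance rn cancels,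
  but it remains in 1 / c.\<close>

lemma emeasure_SINR_B_cond_greater:
  assumes v: "valid_params p" and r1: "0 < r1" and rn: "r1 \<le> rn" and b: "0 \<le> b" "b < pi"
    and B: "SINR_B_cond_law p r1 rn b \<nu>" and t: "0 < t"
  defines "\<phi> \<equiv> exp t - 1" and "a \<equiv> c_light p * rn * theta_B p / (2 * W_b p * (cos (b / 2))\<^sup>2)"
  shows "emeasure \<nu> {x. ennreal \<phi> < x} =
         ennreal (p_LOS p rn * (real (beams p) - 1) / beams p) *
         ennreal (exp (- lam_cl p * a * (\<phi> * sig_cl p / (sig_t p + \<phi> * sig_cl p)))) *
         L_IC p r1 (\<phi> * r1 powr eta_L p / (sig_t p * cos (b / 2))) a *
         ennreal (exp (- (\<phi> * (4 * pi) ^ 3 * r1 powr eta_L p * rn powr eta_L p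
                           * K_B p * temp p * W_b p)
                       / (P_s p * (G_m p)\<^sup>2 * (wavelength p)\<^sup>2 * cos (b / 2) * sig_t p))) *
         L_D p (\<phi> * (4 * pi) ^ 3 * r1 powr eta_L p * rn powr eta_L p
                 / (P_s p * (G_m p)\<^sup>2 * (wavelength p)\<^sup>2 * cos (b / 2) * sig_t p))"
proof -
  define q where "q = p_LOS p rn * ((real (beams p) - 1) / beams p)"
  obtain LS LI LD where S: "clutter_law p (area_bi p rn b) LS" and I: "IC_law p r1 (area_bi p rn b) LI" and D: "D_law p LD"
    and \<nu>: "\<nu> = distr (measure_pmf (bernoulli_pmf q) \<Otimes>\<^sub>M exp_law (sig_t p) \<Otimes>\<^sub>M LS \<Otimes>\<^sub>M LI \<Otimes>\<^sub>M LD) borel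
          (\<lambda>(c1, \<sigma>, S, (I1, I2), (IL, IN)).
             of_bool c1 *
             ennreal (kappa p * cos (b / 2) * r1 powr (- eta_L p) * rn powr (- eta_L p)) * \<sigma>
             / (ennreal (kappa p * cos (b / 2) * r1 powr (- eta_L p) * rn powr (- eta_L p)) * S
                + ennreal (kappa p * rn powr (- eta_L p)) * (I1 + I2)
                + ennreal (noise p) + IL + IN))"
    using B unfolding SINR_B_cond_law_def q_def by blast
  have rn0: "0 < rn" using r1 rn by simp
  have cs: "0 < cos (b / 2)" using b by (intro cos_gt_zero_pi) auto
  have area: "a = area_bi p rn b" by (simp add: a_def area_bi_def)
  have pos: "sig_t p > 0" "sig_cl p > 0" "kappa p > 0" "noise p > 0" "area_bi p rn b \<ge> 0"
    using v rn0 by (auto simp: valid_params_def kappa_def noise_def area_bi_def)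
  have par: "P_s p > 0" "G_m p > 0" "wavelength p > 0"
    using v by (auto simp: valid_params_def)
  have q: "0 \<le> q" "q \<le> 1"
  proof -
    have "beams p \<ge> 1" using v by (simp add: valid_params_def)
    then have "0 \<le> (real (beams p) - 1) / beams p" "(real (beams p) - 1) / beams p \<le> 1"
      by (auto simp: field_simps)
    moreover have "0 \<le> p_LOS p rn" "p_LOS p rn \<le> 1"
      using p_LOS_bounds[OF v, of rn] rn0 by auto
    ultimately show "0 \<le> q" "q \<le> 1"
      unfolding q_def by (blast intro: mult_nonneg_nonneg mult_le_one)+
  qed
  define c where "c = kappa p * cos (b / 2) * r1 powr (- eta_L p) * rn powr (- eta_L p)"
  define c2 where "c2 = kappa p * rn powr (- eta_L p)"
  have c: "c > 0" "c2 \<ge> 0" using pos r1 rn0 cs by (auto simp: c_def c2_def)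
  note LS = clutter_law_laplace[OF v S pos(5)]
  note LI = IC_law_laplace[OF v I less_imp_le[OF r1] pos(5)]
  note LD = D_law_laplace[OF v D]
  define W where "W = exp_law (sig_t p) \<Otimes>\<^sub>M LS \<Otimes>\<^sub>M LI \<Otimes>\<^sub>M LD"
  \<comment> \<open>The vanishing last summand gives T the shape of the general quotient with z =
    0.\<close>
  define T where "T = (\<lambda>w :: ennreal \<times> ennreal \<times> (ennreal \<times> ennreal) \<times> (ennreal \<times> ennreal).
    ennreal c * fst w / (ennreal c * fst (snd w) + ennreal c2 * (fst (fst (snd (snd w))) + snd (fst (snd (snd w))))
      + ennreal (noise p) + fst (snd (snd (snd w))) + snd (snd (snd (snd w))) + ennreal 0))"
  have \<nu>': "\<nu> = distr (measure_pmf (bernoulli_pmf q) \<Otimes>\<^sub>M W) borel (\<lambda>w. of_bool (fst w) * T (snd w))"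
    unfolding \<nu> W_def T_def c_def[symmetric] c2_def[symmetric]
    by (simp add: case_prod_beta' ennreal_times_divide mult.assoc)
  have \<phi>: "0 < \<phi>" using t by (simp add: \<phi>_def)
  note R = emeasure_SINR_greater[OF pos(1) \<phi> c pos(4) order_refl LS(1,2) LI(1,2)[OF order_refl] LD(1,2)[OF order_refl],
    folded W_def]
  interpret W: prob_space W by (rule R(1))
  have T[measurable]: "T \<in> borel_measurable W" using R(2) unfolding T_def .
  let ?A = "(P_s p * (G_m p)\<^sup>2 * (wavelength p)\<^sup>2 * cos (b / 2) * sig_t p)"
  have e0: "\<phi> / sig_t p * sig_cl p / (1 + \<phi> / sig_t p * sig_cl p) = \<phi> * sig_cl p / (sig_t p + \<phi> * sig_cl p)"
  proof -
    have "sig_t p + \<phi> * sig_cl p > 0" using pos \<phi> by (simp add: add_pos_pos)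
    moreover have "1 + \<phi> / sig_t p * sig_cl p = (sig_t p + \<phi> * sig_cl p) / sig_t p"
      using pos by (simp add: field_simps)
    ultimately show ?thesis using pos by (simp add: field_simps)
  qed
  have rr: "r1 powr (- eta_L p) = inverse (r1 powr eta_L p)" "rn powr (- eta_L p) = inverse (rn powr eta_L p)"
    "r1 powr eta_L p > 0" "rn powr eta_L p > 0"
    using r1 rn0 by (auto simp: powr_minus)
  have e1: "\<phi> * c2 / (c * sig_t p) = \<phi> * r1 powr eta_L p / (sig_t p * cos (b / 2))"
    using rr(3,4) pos cs unfolding c_def c2_def rr(1,2) by (simp add: field_simps)
  have e2: "\<phi> / (c * sig_t p) = \<phi> * (4 * pi) ^ 3 * r1 powr eta_L p * rn powr eta_L p / ?A"
    using rr(3,4) pos par cs unfolding c_def rr(1,2) kappa_def by (simp add: field_simps)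
  have s: "0 \<le> \<phi> / sig_t p" "0 \<le> \<phi> * r1 powr eta_L p / (sig_t p * cos (b / 2))"
      "0 \<le> \<phi> * (4 * pi) ^ 3 * r1 powr eta_L p * rn powr eta_L p / ?A"
    using \<phi> pos par cs by auto
  have "emeasure \<nu> {x. ennreal \<phi> < x}
      = (\<integral>\<^sup>+ y. indicator {x. ennreal \<phi> < x} y \<partial>\<nu>)"
    by (subst nn_integral_indicator) (auto simp: \<nu>')
  also have "\<dots> = (\<integral>\<^sup>+ w. indicator {x. ennreal \<phi> < x} (of_bool (fst w) * T (snd w)) \<partial>(measure_pmf (bernoulli_pmf q) \<Otimes>\<^sub>M W))"
    unfolding \<nu>' by (subst nn_integral_distr) auto
  also have "\<dots> = (\<integral>\<^sup>+ c1. \<integral>\<^sup>+ w. indicator {x. ennreal \<phi> < x} (of_bool c1 * T w) \<partial>W \<partial>measure_pmf (bernoulli_pmf q))"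
    by (subst W.nn_integral_fst[symmetric]) auto
  also have "\<dots> = (\<integral>\<^sup>+ w. indicator {x. ennreal \<phi> < x} (T w) \<partial>W) * ennreal q"
    using q by simp
  also have "(\<integral>\<^sup>+ w. indicator {x. ennreal \<phi> < x} (T w) \<partial>W) = (\<integral>\<^sup>+ w. indicator {w \<in> space W. ennreal \<phi> < T w} w \<partial>W)"
    by (intro nn_integral_cong) (auto split: split_indicator)
  also have "\<dots> = emeasure W {w \<in> space W. ennreal \<phi> < T w}"
    by (rule nn_integral_indicator) measurable
  finally show ?thesis
    unfolding T_def R(3) e1 e2 LS(3)[OF s(1)] LI(3)[OF s(2)] LD(3)[OF s(3)] e0 area
    unfolding noise_def q_def by (simp add: mult_ac)
qed

lemma emeasure_SINR_B_greater:
  assumes v: "valid_params p" and r1: "0 < r1" and n: "2 \<le> n" and B: "SINR_B_law p n r1 \<nu>"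
  shows "prob_space \<nu>" "sets \<nu> = sets borel"
    "0 < t \<Longrightarrow> emeasure \<nu> {x. ennreal (exp t - 1) < x} = P_B p n r1 t"
proof -
  have lam: "lam_BS p > 0" using v by (simp add: valid_params_def)
  have mix: "mixture_law (real_law_on {r1..} (nth_nearest_pdf p n r1) \<Otimes>\<^sub>M angle_law) borel
       (\<lambda>(rn, b). SINR_B_cond_law p r1 rn b) \<nu>"
    using B unfolding SINR_B_law_def .
  have one: "(\<integral>\<^sup>+ x. ennreal (nth_nearest_pdf p n r1 x) * indicator {r1..} x \<partial>lborel) = 1"
    using r1 by (intro nn_integral_nth_nearest_pdf[OF lam _ n]) simp
  have gen: "AE x in lborel. AE b in lborel. \<forall>\<nu>. x \<in> {r1..} \<longrightarrow> b \<in> {0..pi} \<longrightarrow>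
      (\<lambda>(rn, b). SINR_B_cond_law p r1 rn b) (x, b) \<nu> \<longrightarrow> P x b \<nu>"
    if "\<And>rn b \<nu>. r1 \<le> rn \<Longrightarrow> 0 \<le> b \<Longrightarrow> b < pi \<Longrightarrow> SINR_B_cond_law p r1 rn b \<nu> \<Longrightarrow> P rn b \<nu>"
    for P :: "real \<Rightarrow> real \<Rightarrow> ennreal measure \<Rightarrow> bool"
  proof (rule AE_I2)
    fix x
    have "AE b in lborel. b \<noteq> pi" by (rule AE_lborel_singleton)
    then show "AE b in lborel. \<forall>\<nu>. x \<in> {r1..} \<longrightarrow> b \<in> {0..pi} \<longrightarrow>
      (\<lambda>(rn, b). SINR_B_cond_law p r1 rn b) (x, b) \<nu> \<longrightarrow> P x b \<nu>"
      by eventually_elim (auto intro!: that)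
  qed
  have M: "prob_space (real_law_on {r1..} (nth_nearest_pdf p n r1) \<Otimes>\<^sub>M angle_law)"
    by (intro prob_space_pair prob_space_real_law_on one prob_space_angle_law) auto
  show "prob_space \<nu>" and sets: "sets \<nu> = sets borel"
    by (rule mixture_law_prob_space[OF mix M])+
  assume t: "0 < t"
  have F: "indicator {x. ennreal (exp t - 1) < x} \<in> borel_measurable (borel :: ennreal measure)" by simp
  have ind: "(\<integral>\<^sup>+ y. indicator {x. ennreal (exp t - 1) < x} y \<partial>\<nu>') = emeasure \<nu>' {x. ennreal (exp t - 1) < x}"
    if "sets \<nu>' = sets borel" for \<nu>'
    using that by (intro nn_integral_indicator) simp
  \<comment> \<open>The conditional relation fixes the sigma-algebra, since it presents its measures
    as push-forwards to Borel sets; this lets \<open>ind\<close> rewrite indicator integrals for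
    every measure in the relation.\<close>
  have sB: "sets \<nu>' = sets borel" if "SINR_B_cond_law p r1 rn b \<nu>'" for rn b \<nu>'
    using that unfolding SINR_B_cond_law_def by auto
  note R = mixture_law_real_angle(3)[OF mix measurable_nth_nearest_pdf _ one F
      gen[OF trans[OF ind[OF sB] emeasure_SINR_B_cond_greater[OF v r1 _ _ _ _ t]]]]
  show "emeasure \<nu> {x. ennreal (exp t - 1) < x} = P_B p n r1 t"
    unfolding P_B_def Let_def using R unfolding nth_nearest_pdf_def ind[OF sets] by simp
qed

section \<open>The average rate\<close>

text \<open>The inequality exp t - 1 < y means t < ln (1 + y), so the integral is the length of [0,
  ln (1 + y)), and the length of the whole half-line for x = \<infinity>. This is the origin of the
  threshold \<phi> = exp t - 1.\<close>

lemma log1p_ennreal_layer_cake: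
  "log1p_ennreal x = (\<integral>\<^sup>+ t\<in>{0..}. indicator {t. ennreal (exp t - 1) < x} t \<partial>lborel)"
proof (cases x)
  case top
  have "emeasure lborel {0::real..} = \<infinity>"
  proof (rule ccontr)
    assume "emeasure lborel {0::real..} \<noteq> \<infinity>"
    then obtain n where n: "emeasure lborel {0::real..} < of_nat n"
      by (metis ennreal_Ex_less_of_nat less_top infinity_ennreal_def)
    have "emeasure lborel {0..real n} \<le> emeasure lborel {0::real..}"
      by (intro emeasure_mono) auto
    with n show False by (simp add: ennreal_of_nat_eq_real_of_nat)
  qed
  then show ?thesis
    using top by (simp add: log1p_ennreal_def)
next
  case (real y)
  have *: "ennreal (exp t - 1) < x \<longleftrightarrow> t < ln (1 + y)" if "0 \<le> t" for t
  proof -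
    have "ennreal (exp t - 1) < x \<longleftrightarrow> exp t < 1 + y"
      using that real by (auto simp: ennreal_less_iff)
    also have "\<dots> \<longleftrightarrow> exp t < exp (ln (1 + y))"
      using real by simp
    finally show ?thesis by simp
  qed
  have "(\<integral>\<^sup>+ t\<in>{0..}. indicator {t. ennreal (exp t - 1) < x} t \<partial>lborel)
      = (\<integral>\<^sup>+ t. indicator {0..<ln (1 + y)} t \<partial>lborel)"
    using * by (intro nn_integral_cong) (auto split: split_indicator)
  then show ?thesis
    using real by (simp add: log1p_ennreal_def)
qed

lemma measurable_log1p_ennreal [measurable]: "log1p_ennreal \<in> borel_measurable borel"
  unfolding log1p_ennreal_def[abs_def] by measurable

lemma nn_integral_log1p_ennreal:
  assumes "prob_space M" and [measurable]: "X \<in> borel_measurable M"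
  shows "(\<integral>\<^sup>+ w. log1p_ennreal (X w) \<partial>M)
    = (\<integral>\<^sup>+ t\<in>{0..}. emeasure M {w \<in> space M. ennreal (exp t - 1) < X w} \<partial>lborel)"
proof -
  interpret prob_space M by fact
  interpret pair_sigma_finite M "lborel :: real measure" by unfold_locales
  let ?f = "\<lambda>(w, t). indicator {w \<in> space M. ennreal (exp t - 1) < X w} w * indicator {0..} t :: ennreal"
  have m: "?f \<in> borel_measurable (M \<Otimes>\<^sub>M lborel)"
    unfolding indicator_def by measurable
  have "(\<integral>\<^sup>+ w. log1p_ennreal (X w) \<partial>M) = (\<integral>\<^sup>+ w. \<integral>\<^sup>+ t. ?f (w, t) \<partial>lborel \<partial>M)"
    unfolding log1p_ennreal_layer_cake by (intro nn_integral_cong) (auto split: split_indicator)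
  also have "\<dots> = (\<integral>\<^sup>+ t. \<integral>\<^sup>+ w. ?f (w, t) \<partial>M \<partial>lborel)"
    using Fubini[OF m] by simp
  also have "\<dots> = (\<integral>\<^sup>+ t\<in>{0..}. emeasure M {w \<in> space M. ennreal (exp t - 1) < X w} \<partial>lborel)"
    by (intro nn_integral_cong) (simp add: nn_integral_multc)
  finally show ?thesis .
qed

text \<open>The complement is the box on which all coordinates stay at or below y, and its product
  measure is a product of complementary tails. The hypothesis N \<ge> 1 makes the maximum range over
  a nonempty set.\<close>

lemma emeasure_PiM_Max_greater:
  fixes L :: "nat \<Rightarrow> ennreal measure"
  assumes N: "1 \<le> N" and L: "\<And>n. n \<in> {1..N} \<Longrightarrow> prob_space (L n)" "\<And>n. n \<in> {1..N} \<Longrightarrow> sets (L n) = sets borel"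
  shows "emeasure (PiM {1..N} L) {x \<in> space (PiM {1..N} L). y < Max ((\<lambda>n. x n) ` {1..N})}
    = 1 - (\<Prod>n=1..N. 1 - emeasure (L n) {x. y < x})"
proof -
  interpret prob_space "PiM {1..N} L" by (rule prob_space_PiM[OF L(1)])
  let ?S = "space (PiM {1..N} L)"
  have space: "space (L n) = UNIV" if "n \<in> {1..N}" for n
    using sets_eq_imp_space_eq[OF L(2)[OF that]] by simp
  have S: "?S = Pi\<^sub>E {1..N} (\<lambda>_. UNIV)"
    unfolding space_PiM using space by (intro PiE_cong) auto
  have meas: "Pi\<^sub>E {1..N} (\<lambda>_. {..y}) \<in> sets (PiM {1..N} L)"
    by (intro sets_PiM_I_finite) (auto simp: L(2))
  have fin: "emeasure (PiM {1..N} L) (Pi\<^sub>E {1..N} (\<lambda>_. {..y})) \<noteq> \<infinity>"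
    unfolding infinity_ennreal_def by (rule emeasure_finite)
  have "{x \<in> ?S. y < Max ((\<lambda>n. x n) ` {1..N})} = ?S - Pi\<^sub>E {1..N} (\<lambda>_. {..y})"
  proof (rule set_eqI)
    fix x
    have "y < Max ((\<lambda>n. x n) ` {1..N}) \<longleftrightarrow> (\<exists>n\<in>{1..N}. \<not> x n \<le> y)"
      using N by (subst Max_gr_iff) (auto simp: not_le)
    then show "x \<in> {x \<in> ?S. y < Max ((\<lambda>n. x n) ` {1..N})} \<longleftrightarrow> x \<in> ?S - Pi\<^sub>E {1..N} (\<lambda>_. {..y})"
      unfolding S mem_Collect_eq Diff_iff PiE_iff by blast
  qed
  then have "emeasure (PiM {1..N} L) {x \<in> ?S. y < Max ((\<lambda>n. x n) ` {1..N})}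
      = 1 - emeasure (PiM {1..N} L) (Pi\<^sub>E {1..N} (\<lambda>_. {..y}))"
    by (simp only: emeasure_compl[OF meas fin] emeasure_space_1)
  also have "emeasure (PiM {1..N} L) (Pi\<^sub>E {1..N} (\<lambda>_. {..y})) = (\<Prod>n=1..N. emeasure (L n) {..y})"
  proof -
    have "prod_emb {1..N} L {1..N} (Pi\<^sub>E {1..N} (\<lambda>_. {..y})) = Pi\<^sub>E {1..N} (\<lambda>_. {..y})"
      using space by (intro prod_emb_id) (auto simp: PiE_iff)
    then show ?thesis
      using emeasure_PiM_emb[of "{1..N}" L "{1..N}" "\<lambda>_. {..y}"] L by simp
  qed
  also have "(\<Prod>n=1..N. emeasure (L n) {..y}) = (\<Prod>n=1..N. 1 - emeasure (L n) {x. y < x})"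
  proof (rule prod.cong)
    fix n assume n: "n \<in> {1..N}"
    interpret Ln: prob_space "L n" by (rule L(1)[OF n])
    have "{..y} = space (L n) - {x. y < x}" unfolding space[OF n] by auto
    then show "emeasure (L n) {..y} = 1 - emeasure (L n) {x. y < x}"
      using L(2)[OF n] by (simp add: emeasure_compl Ln.emeasure_space_1)
  qed simp
  finally show ?thesis .
qed

text \<open>Disintegrates the joint law of Z and X along Z and integrates a function of the second
  coordinate, so the copy of z carried by \<open>Pair z\<close> drops out. The relation C is handed
  on almost everywhere, as it is guaranteed only there.\<close>

lemma conditional_law_nn_integral:
  assumes C: "conditional_law P MZ Z MX X C" and P: "prob_space P" and F[measurable]: "F \<in> borel_measurable MX"
  obtains \<kappa> where "AE z in distr P MZ Z. prob_space (\<kappa> z) \<and> sets (\<kappa> z) = sets MX \<and> C z (\<kappa> z)"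
    "(\<lambda>z. \<integral>\<^sup>+ x. F x \<partial>\<kappa> z) \<in> borel_measurable MZ"
    "(\<integral>\<^sup>+ w. F (X w) \<partial>P) = (\<integral>\<^sup>+ z. \<integral>\<^sup>+ x. F x \<partial>\<kappa> z \<partial>distr P MZ Z)"
proof -
  have Z[measurable]: "Z \<in> measurable P MZ" and X[measurable]: "X \<in> measurable P MX"
    using C unfolding conditional_law_def by blast+
  obtain \<kappa> where \<kappa>: "\<kappa> \<in> measurable MZ (prob_algebra MX)" "AE z in distr P MZ Z. C z (\<kappa> z)"
    "distr P (MZ \<Otimes>\<^sub>M MX) (\<lambda>w. (Z w, X w)) =
          bind (distr P MZ Z) (\<lambda>z. distr (\<kappa> z) (MZ \<Otimes>\<^sub>M MX) (Pair z))"
    using C unfolding conditional_law_def by blast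
  have \<kappa>s[measurable]: "\<kappa> \<in> measurable MZ (subprob_algebra MX)"
    by (rule measurable_prob_algebraD[OF \<kappa>(1)])
  have space: "prob_space (\<kappa> z) \<and> sets (\<kappa> z) = sets MX" if "z \<in> space MZ" for z
    using measurable_space[OF \<kappa>(1) that] by (simp add: space_prob_algebra)
  have 1: "AE z in distr P MZ Z. prob_space (\<kappa> z) \<and> sets (\<kappa> z) = sets MX \<and> C z (\<kappa> z)"
    using \<kappa>(2) AE_space by eventually_elim (simp add: space)
  have 2: "(\<lambda>z. \<integral>\<^sup>+ x. F x \<partial>\<kappa> z) \<in> borel_measurable MZ"
    by (rule measurable_compose[OF \<kappa>s nn_integral_measurable_subprob_algebra[OF F]])
  have K: "(\<lambda>z. distr (\<kappa> z) (MZ \<Otimes>\<^sub>M MX) (Pair z)) \<in> measurable (distr P MZ Z) (subprob_algebra (MZ \<Otimes>\<^sub>M MX))"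
    by (rule measurable_distr2[where M=MX]) measurable
  have "(\<integral>\<^sup>+ w. F (X w) \<partial>P) = (\<integral>\<^sup>+ y. F (snd y) \<partial>distr P (MZ \<Otimes>\<^sub>M MX) (\<lambda>w. (Z w, X w)))"
    by (subst nn_integral_distr) auto
  also have "\<dots> = (\<integral>\<^sup>+ z. \<integral>\<^sup>+ y. F (snd y) \<partial>distr (\<kappa> z) (MZ \<Otimes>\<^sub>M MX) (Pair z) \<partial>distr P MZ Z)"
    unfolding \<kappa>(3) by (rule nn_integral_bind[OF _ K]) measurable
  also have "\<dots> = (\<integral>\<^sup>+ z. \<integral>\<^sup>+ x. F x \<partial>\<kappa> z \<partial>distr P MZ Z)"
  proof (rule nn_integral_cong)
    fix z assume "z \<in> space (distr P MZ Z)"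
    then have z: "z \<in> space MZ" by simp
    have [measurable_cong]: "sets (\<kappa> z) = sets MX" using space[OF z] by simp
    show "(\<integral>\<^sup>+ y. F (snd y) \<partial>distr (\<kappa> z) (MZ \<Otimes>\<^sub>M MX) (Pair z)) = (\<integral>\<^sup>+ x. F x \<partial>\<kappa> z)"
      using z by (subst nn_integral_distr) (auto intro!: measurable_Pair1')
  qed
  finally show thesis by (rule that[OF 1 2])
qed

theorem theorem3:
  fixes p :: params and N :: nat
    and P :: "'w measure" and R1 :: "'w \<Rightarrow> real" and SINR :: "nat \<Rightarrow> 'w \<Rightarrow> ennreal"
  assumes "valid_params p" and "N \<ge> 1" and "sensing_model p N P R1 SINR"
  shows "avg_rate p N P SINR =
    of_nat (beams p) *
    (\<integral>\<^sup>+ r1\<in>{0..}.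
       (\<integral>\<^sup>+ t\<in>{0..}. (1 - (1 - P_M p r1 t) * (\<Prod>n=2..N. 1 - P_B p n r1 t)) \<partial>lborel)
       * ennreal (2 * pi * lam_BS p * r1 * exp (- pi * lam_BS p * r1\<^sup>2)) \<partial>lborel)"
proof -
  let ?MX = "PiM {1..N} (\<lambda>_. borel) :: (nat \<Rightarrow> ennreal) measure"
  let ?I = "\<lambda>r1. \<integral>\<^sup>+ t\<in>{0..}. (1 - (1 - P_M p r1 t) * (\<Prod>n=2..N. 1 - P_B p n r1 t)) \<partial>lborel"
  define X where "X w = (\<lambda>n\<in>{1..N}. SINR n w)" for w
  define G :: "(nat \<Rightarrow> ennreal) \<Rightarrow> ennreal" where "G x = Max ((\<lambda>n. x n) ` {1..N})" for x
  define C where "C = (\<lambda>r1 \<mu>. \<exists>L. SINR_M_law p r1 (L 1) \<and> (\<forall>n\<in>{2..N}. SINR_B_law p n r1 (L n)) \<and> \<mu> = PiM {1..N} L)"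
  have P: "prob_space P" and D: "distributed P lborel R1 (\<lambda>r. ennreal (nearest_pdf p r) * indicator {0..} r)"
    and cond: "conditional_law P borel R1 ?MX X C"
    using assms(3) unfolding sensing_model_def X_def C_def by blast+
  have G[measurable]: "G \<in> borel_measurable ?MX"
    unfolding G_def by (intro borel_measurable_Max) auto
  have net: "SINR_net N SINR w = G (X w)" for w
    unfolding SINR_net_def G_def X_def by (intro arg_cong[where f=Max] image_cong) auto
  \<comment> \<open>The family L of conditional laws enters only through its tails, which
    \<open>P_M\<close> and \<open>P_B\<close> determine for r1 > 0, so the value depends on r1
    alone.\<close>
  have rate: "(\<integral>\<^sup>+ x. log1p_ennreal (G x) \<partial>\<mu>) = ?I r1"
    if r1: "0 < r1" and \<mu>: "C r1 \<mu>" "prob_space \<mu>" "sets \<mu> = sets ?MX" for r1 \<mu>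
  proof -
    obtain L where L: "SINR_M_law p r1 (L 1)" "\<And>n. n \<in> {2..N} \<Longrightarrow> SINR_B_law p n r1 (L n)" "\<mu> = PiM {1..N} L"
      using \<mu>(1) unfolding C_def by blast
    note M = emeasure_SINR_M_greater[OF assms(1) r1 L(1)]
    have B: "prob_space (L n)" "sets (L n) = sets borel"
        "0 < t \<Longrightarrow> emeasure (L n) {x. ennreal (exp t - 1) < x} = P_B p n r1 t" if "n \<in> {2..N}" for n t
      using emeasure_SINR_B_greater[OF assms(1) r1 _ L(2)[OF that]] that by auto
    have cases: "n = 1 \<or> n \<in> {2..N}" if "n \<in> {1..N}" for n using that by auto
    have PL: "prob_space (L n)" "sets (L n) = sets borel" if "n \<in> {1..N}" for n
      using cases[OF that] M(1,2) B(1,2) by auto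
    have "(\<integral>\<^sup>+ x. log1p_ennreal (G x) \<partial>\<mu>)
        = (\<integral>\<^sup>+ t\<in>{0..}. emeasure \<mu> {x \<in> space \<mu>. ennreal (exp t - 1) < G x} \<partial>lborel)"
      by (rule nn_integral_log1p_ennreal[OF \<mu>(2)]) (simp only: measurable_cong_sets[OF \<mu>(3) refl] G)
    also have "\<dots> = ?I r1"
    proof (rule nn_integral_cong_AE)
      \<comment> \<open>The tail formulas hold for t > 0; the remaining point t = 0 is a null
        set.\<close>
      show "AE t in lborel. emeasure \<mu> {x \<in> space \<mu>. ennreal (exp t - 1) < G x} * indicator {0..} t
          = (1 - (1 - P_M p r1 t) * (\<Prod>n=2..N. 1 - P_B p n r1 t)) * indicator {0..} t"
        using AE_lborel_singleton[of 0]
      proof eventually_elim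
        case (elim t)
        show ?case
        proof (cases "0 < t")
          case True
          have "emeasure \<mu> {x \<in> space \<mu>. ennreal (exp t - 1) < G x}
              = 1 - (\<Prod>n=1..N. 1 - emeasure (L n) {x. ennreal (exp t - 1) < x})"
            unfolding L(3) G_def by (rule emeasure_PiM_Max_greater[OF assms(2) PL])
          \<comment> \<open>Index 1 is the monostatic SINR; splitting it off leaves the bistatic
            indices from 2 to N, an empty product for N = 1.\<close>
          also have "(\<Prod>n=1..N. 1 - emeasure (L n) {x. ennreal (exp t - 1) < x})
              = (1 - P_M p r1 t) * (\<Prod>n=2..N. 1 - emeasure (L n) {x. ennreal (exp t - 1) < x})"
            by (simp only: prod.atLeast_Suc_atMost[OF assms(2)] M(3)[OF True] Suc_1)
          also have "(\<Prod>n=2..N. 1 - emeasure (L n) {x. ennreal (exp t - 1) < x}) = (\<Prod>n=2..N. 1 - P_B p n r1 t)"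
            by (intro prod.cong) (auto simp: B(3)[OF _ True])
          finally show ?thesis by simp
        next
          case False
          with elim show ?thesis by (simp add: indicator_def)
        qed
      qed
    qed
    finally show ?thesis .
  qed
  have F: "(\<lambda>x. log1p_ennreal (G x)) \<in> borel_measurable ?MX" by measurable
  obtain \<kappa> where \<kappa>: "AE z in distr P borel R1. prob_space (\<kappa> z) \<and> sets (\<kappa> z) = sets ?MX \<and> C z (\<kappa> z)"
    "(\<lambda>z. \<integral>\<^sup>+ x. log1p_ennreal (G x) \<partial>\<kappa> z) \<in> borel_measurable borel"
    "(\<integral>\<^sup>+ w. log1p_ennreal (G (X w)) \<partial>P) = (\<integral>\<^sup>+ z. \<integral>\<^sup>+ x. log1p_ennreal (G x) \<partial>\<kappa> z \<partial>distr P borel R1)"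
    using conditional_law_nn_integral[OF cond P F] .
  \<comment> \<open>\<open>conditional_law\<close> refers to the Borel space and
    \<open>distributed\<close> to Lebesgue measure on it; the push-forwards agree since the
    sigma-algebras do.\<close>
  have "distr P borel R1 = distr P lborel R1"
    by (rule distr_cong) auto
  also have "\<dots> = real_law_on {0..} (nearest_pdf p)"
    using D unfolding distributed_def real_law_on_def by blast
  finally have R1: "distr P borel R1 = real_law_on {0..} (nearest_pdf p)" .
  have pdf[measurable]: "nearest_pdf p \<in> borel_measurable borel"
    unfolding nearest_pdf_eq by measurable
  have "(\<integral>\<^sup>+ w. log1p_ennreal (G (X w)) \<partial>P)
      = (\<integral>\<^sup>+ r. ennreal (nearest_pdf p r) * indicator {0..} r * (\<integral>\<^sup>+ x. log1p_ennreal (G x) \<partial>\<kappa> r) \<partial>lborel)"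
    unfolding \<kappa>(3) R1 using \<kappa>(2) by (intro nn_integral_real_law_on) auto
  also have "\<dots> = (\<integral>\<^sup>+ r1\<in>{0..}. ?I r1 * ennreal (nearest_pdf p r1) \<partial>lborel)"
  proof (rule nn_integral_cong_AE)
    \<comment> \<open>The radius 0, excluded in \<open>rate\<close>, is a null set, and negative
      radii are cut off by the indicator.\<close>
    show "AE r in lborel. ennreal (nearest_pdf p r) * indicator {0..} r * (\<integral>\<^sup>+ x. log1p_ennreal (G x) \<partial>\<kappa> r)
        = ?I r * ennreal (nearest_pdf p r) * indicator {0..} r"
      using AE_real_law_on[OF pdf _ \<kappa>(1)[unfolded R1], simplified] AE_lborel_singleton[of 0]
    proof eventually_elim
      case (elim r)
      show ?case
      proof (cases "0 < r \<and> 0 < nearest_pdf p r")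
        case True
        then have "(\<integral>\<^sup>+ x. log1p_ennreal (G x) \<partial>\<kappa> r) = ?I r"
          using elim by (intro rate) auto
        then show ?thesis using True by (simp add: mult.commute)
      next
        case False
        with elim have "r < 0 \<or> nearest_pdf p r \<le> 0" by auto
        then show ?thesis by (auto simp: ennreal_neg)
      qed
    qed
  qed
  finally show ?thesis
    unfolding avg_rate_def net nearest_pdf_def by simp
qed

end
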